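(* Let $w$ be an infinite prime of $F$, $K$ the completion of $F$ at $w$, $\phi$ a rank $r$ Drinfeld $A$-module over $K$ with lattice $\Lambda$ and exponential $e_\phi$, and $\{\omega_i\}_{i=1,\ldots,r}$ an SMB of $\Lambda$. Let $u$ be a finite prime of $A$ and $n$ a positive integer with $|u^n|>|\omega_r|/|\omega_1|$, and let $\{\lambda_i\}_{i=1,\ldots,r}$ be an SMB of $\phi[u^n]$. Then for each $i$ there is a unique $\omega_i'\in\mathbb{C}_\infty$ with $|\omega_i'|<|\omega_1|$ and $e_\phi(\omega_i')=\lambda_i$, and the family $\{u^n\omega_i'\}_{i=1,\ldots,r}$ is an SMB of $\Lambda$.
   Context: Let $q$ be a power of a prime $p$, $A=\mathbb{F}_q[t]$, $F$ a finite extension of $\mathbb{F}_q(t)$. An infinite prime of $F$ is one lying over the place $1/t$. $K$ is the completion of $F$ at $w$, $w$ also denotes its normalized valuation, extended to $K^{\mathrm{sep}}$ and to the completion $\mathbb{C}_\infty$ of an algebraic closure; $|\cdot|$ is the absolute value on $\mathbb{C}_\infty$ extending $|a|=q^{\deg a}$. A rank $r$ Drinfeld $A$-module over $K$: $a\mapsto\phi_a$ with $\phi_t(X)=tX+a_1X^q+\cdots+a_rX^{q^r}$, $a_r\ne0$; $a\cdot_\phi x=\phi_a(x)$. For a finite prime (monic irreducible) $u\in A$, $\phi[u^n]$ is the $A/u^n$-module of roots of $\phi_{u^n}(X)$ in $K^{\mathrm{sep}}$. Uniformization: an $A$-lattice $\Lambda\subset\mathbb{C}_\infty$ of rank $r$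 (Galois-stable) with $e_\phi(z)=z\prod_{\mu\in\Lambda\setminus\{0\}}(1-z/\mu)$ surjective, kernel $\Lambda$, $e_\phi(az)=\phi_a(e_\phi(z))$. An SMB of $\Lambda$: $\{\omega_i\}\subset\Lambda$ with, for each $i$, $\omega_1,\dots,\omega_i$ $A$-linearly independent and $|\omega_i|$ minimal among $|\omega|$, $\omega\in\Lambda$ with $\omega_1,\dots,\omega_{i-1},\omega$ $A$-linearly independent. An SMB of $\phi[u^n]$: $\{\lambda_i\}\subset\phi[u^n]$ with, for each $i$, $\lambda_1,\dots,\lambda_i$ $A/u^n$-linearly independent and $w(\lambda_i)$ largest among $w(\lambda)$ for $\lambda\in\phi[u^n]$ with $\lambda_1,\dots,\lambda_{i-1},\lambda$ $A/u^n$-linearly independent. *)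

theory Defs
  imports "HOL-Analysis.Analysis" "HOL-Computational_Algebra.Polynomial"
begin

text \<open>
  Throughout, \<open>'k\<close> is the finite field with \<open>q = CARD('k)\<close> elements, \<open>A = 'k poly\<close> with
  \<open>t = [:0, 1:]\<close>, and \<open>'c\<close> is the field \<open>\<complex>\<^sub>\<infinity>\<close>, whose absolute value is \<open>absv\<close>.  The inclusion
  of \<open>A\<close> into \<open>\<complex>\<^sub>\<infinity>\<close> is \<open>emb\<close>; the fields \<open>F\<close> and \<open>K\<close> are subfields of \<open>\<complex>\<^sub>\<infinity>\<close>.
  All families are indexed by \<open>{1..r}\<close>.
\<close>

definition absv :: "'c::{field,metric_space} \<Rightarrow> real" where
  "absv x = dist x 0"

definition is_subfield :: "'c::field set \<Rightarrow> bool" where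
  "is_subfield S \<longleftrightarrow> 0 \<in> S \<and> 1 \<in> S \<and>
     (\<forall>x\<in>S. \<forall>y\<in>S. x + y \<in> S \<and> x * y \<in> S) \<and> (\<forall>x\<in>S. - x \<in> S \<and> inverse x \<in> S)"

definition rat_funs :: "('k::field poly \<Rightarrow> 'c::field) \<Rightarrow> 'c set" where
  "rat_funs emb = {emb a / emb b | a b. b \<noteq> 0}"

definition finite_extension :: "'c::field set \<Rightarrow> 'c set \<Rightarrow> bool" where
  "finite_extension L M \<longleftrightarrow> is_subfield L \<and> is_subfield M \<and> L \<subseteq> M \<and>
     (\<exists>B. finite B \<and> B \<subseteq> M \<and> (\<forall>x\<in>M. \<exists>c. (\<forall>b\<in>B. c b \<in> L) \<and> x = (\<Sum>b\<in>B. c b * b)))"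

text \<open>A valuation on \<open>F\<close> is a function whose value at \<open>0\<close> (and outside \<open>F\<close>) is irrelevant.\<close>

definition normalized_valuation :: "'c::field set \<Rightarrow> ('c \<Rightarrow> int) \<Rightarrow> bool" where
  "normalized_valuation F w \<longleftrightarrow>
     (\<forall>x\<in>F - {0}. \<forall>y\<in>F - {0}. w (x * y) = w x + w y) \<and>
     (\<forall>x\<in>F - {0}. \<forall>y\<in>F - {0}. x + y \<noteq> 0 \<longrightarrow> w (x + y) \<ge> min (w x) (w y)) \<and>
     w ` (F - {0}) = UNIV"

text \<open>The valuation of \<open>\<bbbF>\<^sub>q(t)\<close> at the place \<open>1/t\<close> is \<open>a/b \<mapsto> deg b - deg a\<close>.\<close>

definition infinite_prime :: "('k::field poly \<Rightarrow> 'c::field) \<Rightarrow> 'c set \<Rightarrow> ('c \<Rightarrow> int) \<Rightarrow> bool" where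
  "infinite_prime emb F w \<longleftrightarrow> normalized_valuation F w \<and>
     (\<exists>e>0. \<forall>a b. a \<noteq> 0 \<longrightarrow> b \<noteq> 0 \<longrightarrow>
        w (emb a / emb b) = e * (int (degree b) - int (degree a)))"

definition ramification_index :: "('k::field poly \<Rightarrow> 'c::field) \<Rightarrow> ('c \<Rightarrow> int) \<Rightarrow> int" where
  "ramification_index emb w = - w (emb [:0, 1:])"

definition algebraic_over :: "'c::field set \<Rightarrow> 'c set" where
  "algebraic_over K = {x. \<exists>p. p \<noteq> 0 \<and> set (coeffs p) \<subseteq> K \<and> poly p x = 0}"

definition separable_closure :: "'c::field set \<Rightarrow> 'c set" where
  "separable_closure K =
     {x. \<exists>p. p \<noteq> 0 \<and> set (coeffs p) \<subseteq> K \<and> coprime p (pderiv p) \<and> poly p x = 0}"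

text \<open>
  The type \<open>'c\<close> is a complete metric space by its sort.  The assumption \<open>absv_F\<close> says that
  the absolute value of \<open>\<complex>\<^sub>\<infinity>\<close> induces the prime \<open>w\<close> on \<open>F\<close>, the scaling being forced by \<open>absv t = q\<close>; hence the topological closure of \<open>F\<close> is the
  completion \<open>K\<close> of \<open>F\<close> at \<open>w\<close>.  The last two assumptions say that \<open>\<complex>\<^sub>\<infinity>\<close> is the completion of
  an algebraic closure of \<open>K\<close>.
\<close>

locale infinite_completion =
  fixes emb :: "'k::{finite,field} poly \<Rightarrow> 'c::{field,complete_space}"
    and F :: "'c set" and w :: "'c \<Rightarrow> int" and K :: "'c set"
  assumes emb_1: "emb 1 = 1"
    and emb_add: "emb (a + b) = emb a + emb b"
    and emb_mult: "emb (a * b) = emb a * emb b"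
    and dist_absv: "dist x y = absv (x - y)"
    and absv_mult: "absv (x * y) = absv x * absv y"
    and absv_ultrametric: "absv (x + y) \<le> max (absv x) (absv y)"
    and absv_emb: "a \<noteq> 0 \<Longrightarrow> absv (emb a) = real CARD('k) ^ degree a"
    and finite_ext: "finite_extension (rat_funs emb) F"
    and prime: "infinite_prime emb F w"
    and absv_F: "x \<in> F \<Longrightarrow> x \<noteq> 0 \<Longrightarrow>
      absv x = real CARD('k) powr (- real_of_int (w x) / real_of_int (ramification_index emb w))"
    and K_eq: "K = closure F"
    and alg_closed: "set (coeffs p) \<subseteq> algebraic_over K \<Longrightarrow> degree p > 0 \<Longrightarrow>
      \<exists>x\<in>algebraic_over K. poly p x = 0"
    and dense: "closure (algebraic_over K) = UNIV"

text \<open>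
  The extension of \<open>w\<close> to \<open>\<complex>\<^sub>\<infinity>\<close>: the valuation proportional to \<open>- log |z|\<close> that restricts to
  \<open>w\<close> on \<open>F\<close> (lemma \<open>w_ext_F\<close>).
\<close>

definition w_ext :: "('k::{finite,field} poly \<Rightarrow> 'c::{field,metric_space}) \<Rightarrow> ('c \<Rightarrow> int) \<Rightarrow> 'c \<Rightarrow> ereal" where
  "w_ext emb w z = (if z = 0 then \<infinity>
     else ereal (- real_of_int (ramification_index emb w) * log (real CARD('k)) (absv z)))"

lemma (in infinite_completion) w_ext_F:
  assumes "x \<in> F" "x \<noteq> 0"
  shows "w_ext emb w x = ereal (real_of_int (w x))"
proof -
  obtain e where "e > 0" and e: "\<And>a b. a \<noteq> 0 \<Longrightarrow> b \<noteq> 0 \<Longrightarrow>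
      w (emb a / emb b) = e * (int (degree b) - int (degree a))"
    using prime unfolding infinite_prime_def by blast
  have "w (emb [:0, 1:]) = - e"
    using e[of "[:0, 1:]" 1] by (simp add: emb_1)
  hence "ramification_index emb w > 0"
    using \<open>e > 0\<close> by (simp add: ramification_index_def)
  moreover have "card {0, 1 :: 'k} \<le> CARD('k)"
    by (rule card_mono) auto
  hence "real CARD('k) > 1" by simp
  ultimately show ?thesis
    using assms absv_F[OF assms] by (simp add: w_ext_def)
qed

text \<open>The twisted polynomials \<open>K{\<tau>}\<close>, as \<open>q\<close>-polynomials under composition.\<close>

definition twisted_polys :: "nat \<Rightarrow> 'c::field set \<Rightarrow> 'c poly set" where
  "twisted_polys q K = {p. set (coeffs p) \<subseteq> K \<and> (\<forall>m. coeff p m \<noteq> 0 \<longrightarrow> (\<exists>i. m = q ^ i))}"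

definition drinfeld_module ::
  "('k::{finite,field} poly \<Rightarrow> 'c::field) \<Rightarrow> 'c set \<Rightarrow> nat \<Rightarrow> ('k poly \<Rightarrow> 'c poly) \<Rightarrow> bool" where
  "drinfeld_module emb K r \<phi> \<longleftrightarrow> r \<ge> 1 \<and>
     (\<forall>a. \<phi> a \<in> twisted_polys CARD('k) K) \<and>
     (\<forall>a b. \<phi> (a + b) = \<phi> a + \<phi> b) \<and>
     (\<forall>a b. \<phi> (a * b) = pcompose (\<phi> a) (\<phi> b)) \<and>
     (\<forall>c. \<phi> [:c:] = [:0, emb [:c:]:]) \<and>
     (\<exists>g. (\<forall>i\<in>{1..r}. g i \<in> K) \<and> g r \<noteq> 0 \<and>
        \<phi> [:0, 1:] = monom (emb [:0, 1:]) 1 + (\<Sum>i=1..r. monom (g i) (CARD('k) ^ i)))"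

definition torsion :: "'c::field set \<Rightarrow> ('k::field poly \<Rightarrow> 'c poly) \<Rightarrow> 'k poly \<Rightarrow> 'c set" where
  "torsion K \<phi> a = {x \<in> separable_closure K. poly (\<phi> a) x = 0}"

definition A_independent :: "('k::field poly \<Rightarrow> 'c::field) \<Rightarrow> nat \<Rightarrow> (nat \<Rightarrow> 'c) \<Rightarrow> bool" where
  "A_independent emb i \<omega> \<longleftrightarrow>
     (\<forall>a. (\<Sum>j=1..i. emb (a j) * \<omega> j) = 0 \<longrightarrow> (\<forall>j\<in>{1..i}. a j = 0))"

text \<open>
  Linear independence over \<open>A/m\<close> for the action \<open>a \<cdot>\<^sub>\<phi> x = \<phi>\<^sub>a(x)\<close> on \<open>\<phi>[m]\<close>; scalars in \<open>A/m\<close> are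
  given by representatives in \<open>A\<close>.
\<close>

definition torsion_independent ::
  "('k::field poly \<Rightarrow> 'c::field poly) \<Rightarrow> 'k poly \<Rightarrow> nat \<Rightarrow> (nat \<Rightarrow> 'c) \<Rightarrow> bool" where
  "torsion_independent \<phi> m i l \<longleftrightarrow>
     (\<forall>a. (\<Sum>j=1..i. poly (\<phi> (a j)) (l j)) = 0 \<longrightarrow> (\<forall>j\<in>{1..i}. m dvd a j))"

text \<open>Since \<open>A\<close> is a principal ideal domain, a lattice of rank \<open>r\<close> is free on \<open>r\<close> generators.\<close>

definition A_lattice :: "('k::field poly \<Rightarrow> 'c::{field,metric_space}) \<Rightarrow> nat \<Rightarrow> 'c set \<Rightarrow> bool" where
  "A_lattice emb r \<Lambda> \<longleftrightarrow>
     (\<exists>b. A_independent emb r b \<and> \<Lambda> = {\<Sum>j=1..r. emb (a j) * b j | a. True}) \<and>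
     (\<forall>R. finite {x \<in> \<Lambda>. absv x \<le> R})"

text \<open>
  \<open>Gal(K\<^sup>s\<^sup>e\<^sup>p/K)\<close> acts on \<open>\<complex>\<^sub>\<infinity>\<close> by continuity, as the group of continuous automorphisms over \<open>K\<close>.
\<close>

definition galois_stable :: "'c::{field,topological_space} set \<Rightarrow> 'c set \<Rightarrow> bool" where
  "galois_stable K \<Lambda> \<longleftrightarrow>
     (\<forall>\<sigma>. bij \<sigma> \<and> (\<forall>x y. \<sigma> (x + y) = \<sigma> x + \<sigma> y) \<and> (\<forall>x y. \<sigma> (x * y) = \<sigma> x * \<sigma> y) \<and>
        continuous_on UNIV \<sigma> \<and> (\<forall>x\<in>K. \<sigma> x = x) \<longrightarrow> \<sigma> ` \<Lambda> \<subseteq> \<Lambda>)"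

definition lattice_exp :: "'c::{field,t2_space} set \<Rightarrow> 'c \<Rightarrow> 'c" where
  "lattice_exp \<Lambda> z = z * Lim (finite_subsets_at_top (\<Lambda> - {0})) (\<lambda>S. \<Prod>\<mu>\<in>S. 1 - z / \<mu>)"

definition uniformizes ::
  "('k::field poly \<Rightarrow> 'c::{field,complete_space}) \<Rightarrow> 'c set \<Rightarrow> nat \<Rightarrow> 'c set \<Rightarrow>
     ('k poly \<Rightarrow> 'c poly) \<Rightarrow> bool" where
  "uniformizes emb K r \<Lambda> \<phi> \<longleftrightarrow> A_lattice emb r \<Lambda> \<and> galois_stable K \<Lambda> \<and>
     surj (lattice_exp \<Lambda>) \<and> {z. lattice_exp \<Lambda> z = 0} = \<Lambda> \<and>
     (\<forall>a z. lattice_exp \<Lambda> (emb a * z) = poly (\<phi> a) (lattice_exp \<Lambda> z))"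

definition SMB_lattice ::
  "('k::field poly \<Rightarrow> 'c::{field,metric_space}) \<Rightarrow> nat \<Rightarrow> 'c set \<Rightarrow> (nat \<Rightarrow> 'c) \<Rightarrow> bool" where
  "SMB_lattice emb r \<Lambda> v \<longleftrightarrow>
     (\<forall>i\<in>{1..r}. v i \<in> \<Lambda> \<and> A_independent emb i v \<and>
        (\<forall>x\<in>\<Lambda>. A_independent emb i (v(i := x)) \<longrightarrow> absv (v i) \<le> absv x))"

definition SMB_torsion ::
  "('k::{finite,field} poly \<Rightarrow> 'c::{field,metric_space}) \<Rightarrow> ('c \<Rightarrow> int) \<Rightarrow> 'c set \<Rightarrow> nat \<Rightarrow>
     ('k poly \<Rightarrow> 'c poly) \<Rightarrow> 'k poly \<Rightarrow> (nat \<Rightarrow> 'c) \<Rightarrow> bool" where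
  "SMB_torsion emb w K r \<phi> m l \<longleftrightarrow>
     (\<forall>i\<in>{1..r}. l i \<in> torsion K \<phi> m \<and> torsion_independent \<phi> m i l \<and>
        (\<forall>x\<in>torsion K \<phi> m. torsion_independent \<phi> m i (l(i := x)) \<longrightarrow>
           w_ext emb w x \<le> w_ext emb w (l i)))"

end

theory Submission
  imports Defs "HOL-Computational_Algebra.Polynomial_Factorial"
begin

text \<open>
  The exponential is a limit of polynomials attached to finite subgroups of \<open>\<Lambda>\<close>, hence additive;
  it preserves absolute values below \<open>|\<omega>\<^sub>1|\<close> and does not decrease those of vectors that are shortest
  in their coset modulo \<open>\<Lambda>\<close>.  Through it, independence of torsion points over \<open>A/u\<^sup>n\<close> becomes
  independence of vectors of \<open>u\<^sup>-\<^sup>n\<Lambda>\<close> modulo \<open>\<Lambda>\<close>, which amounts to linear independence over the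
  field \<open>A/u\<close>.  Minimality makes \<open>\<omega>\<^sub>1, \<dots>, \<omega>\<^sub>i\<close> independent modulo \<open>u\<close>, so by Steinitz exchange
  some \<open>e(\<omega>\<^sub>j/u\<^sup>n)\<close> with \<open>j \<le> i\<close> competes with \<open>\<lambda>\<^sub>i\<close>, which gives \<open>|\<lambda>\<^sub>i| \<le> |\<omega>\<^sub>i|/|u\<^sup>n| < |\<omega>\<^sub>1|\<close>.
  Hence \<open>\<lambda>\<^sub>i\<close> lifts to a unique short vector \<open>\<omega>\<^sub>i'\<close>, and \<open>u\<^sup>n\<omega>\<^sub>i'\<close> is an independent family in \<open>\<Lambda>\<close>
  with \<open>|u\<^sup>n\<omega>\<^sub>i'| \<le> |\<omega>\<^sub>i|\<close>; a second exchange, over the field of fractions of \<open>A\<close>, shows that such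
  a family is again a successive minimum basis.
\<close>

section \<open>Independence modulo a submodule\<close>

definition submod :: "('a::comm_ring_1 \<Rightarrow> 'c::comm_ring_1) \<Rightarrow> 'c set \<Rightarrow> bool" where
  "submod emb N \<longleftrightarrow> 0 \<in> N \<and> (\<forall>x\<in>N. \<forall>y\<in>N. x + y \<in> N) \<and> (\<forall>a. \<forall>x\<in>N. emb a * x \<in> N)"

text \<open>The choice \<open>d = 0\<close>, \<open>N = {0}\<close> gives linear independence over
  A, since 0 divides only 0. The choice \<open>d = u ^ n\<close>, \<open>N = \<Lambda>\<close>
  expresses independence over A/u^n of classes modulo \<Lambda>.\<close>

definition indep_mod ::
  "('a::comm_ring_1 \<Rightarrow> 'c::comm_ring_1) \<Rightarrow> 'a \<Rightarrow> 'c set \<Rightarrow> nat set \<Rightarrow> (nat \<Rightarrow> 'c) \<Rightarrow> bool" where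
  "indep_mod emb d N J v \<longleftrightarrow>
     (\<forall>a. (\<Sum>j\<in>J. emb (a j) * v j) \<in> N \<longrightarrow> (\<forall>j\<in>J. d dvd a j))"

text \<open>
  The element \<open>d\<close> is a prime or \<open>0\<close>, so this covers both the field \<open>A/d\<close> and the field of
  fractions of \<open>A\<close>.  The proof is fraction-free Gaussian elimination.
\<close>

lemma linear_system_mod_prime:
  fixes B :: "'j \<Rightarrow> 'i \<Rightarrow> 'a::comm_ring_1"
  assumes prime: "\<And>x y. d dvd x * y \<Longrightarrow> d dvd x \<or> d dvd y" and "\<not> d dvd 1"
    and "finite S" "finite J" "card S < card J"
  shows "\<exists>c. (\<exists>j\<in>J. \<not> d dvd c j) \<and> (\<forall>k\<in>S. d dvd (\<Sum>j\<in>J. c j * B j k))"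
  using assms(3-5)
proof (induction S arbitrary: J B rule: finite_induct)
  case empty
  hence "J \<noteq> {}" by auto
  thus ?case using \<open>\<not> d dvd 1\<close> by (intro exI[of _ "\<lambda>_. 1"]) auto
next
  case (insert k0 S)
  show ?case
  proof (cases "\<forall>j\<in>J. d dvd B j k0")
    case True
    have "card S < card J" using insert.prems insert.hyps by simp
    then obtain c where "\<exists>j\<in>J. \<not> d dvd c j" "\<forall>k\<in>S. d dvd (\<Sum>j\<in>J. c j * B j k)"
      using insert.IH[of J B] insert.prems by blast
    moreover have "d dvd (\<Sum>j\<in>J. c j * B j k0)"
      using True by (intro dvd_sum) auto
    ultimately show ?thesis by blast
  next
    case False
    then obtain p where p: "p \<in> J" "\<not> d dvd B p k0" by blast
    define J' where "J' = J - {p}"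
    \<comment> \<open>Cross-multiplication with the pivot row \<open>p\<close> makes column
      \<open>k0\<close> of \<open>B'\<close> zero.\<close>
    define B' where "B' j k = B p k0 * B j k - B j k0 * B p k" for j k
    have J: "J = insert p J'" "finite J'" "p \<notin> J'"
      using p insert unfolding J'_def by auto
    have "card S < card J'"
      using insert J by simp
    then obtain c' where c': "\<exists>j\<in>J'. \<not> d dvd c' j" "\<forall>k\<in>S. d dvd (\<Sum>j\<in>J'. c' j * B' j k)"
      using insert.IH[of J' B'] J by blast
    \<comment> \<open>The value at \<open>p\<close> is chosen so that \<open>c\<close> combines the
      rows of \<open>B\<close> exactly as \<open>c'\<close> combines those of
      \<open>B'\<close>.\<close>
    define c where "c j = (if j = p then - (\<Sum>j\<in>J'. c' j * B j k0) else B p k0 * c' j)" for j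
    have sums: "(\<Sum>j\<in>J. c j * B j k) = (\<Sum>j\<in>J'. c' j * B' j k)" for k
    proof -
      have "(\<Sum>j\<in>J. c j * B j k) = c p * B p k + (\<Sum>j\<in>J'. c j * B j k)"
        using J by simp
      also have "(\<Sum>j\<in>J'. c j * B j k) = (\<Sum>j\<in>J'. B p k0 * c' j * B j k)"
        using J(3) by (intro sum.cong) (auto simp: c_def)
      also have "c p * B p k = - (\<Sum>j\<in>J'. c' j * B j k0 * B p k)"
        by (simp add: c_def sum_distrib_right)
      finally show ?thesis
        by (simp add: B'_def algebra_simps sum_subtractf)
    qed
    have "d dvd (\<Sum>j\<in>J. c j * B j k)" if "k \<in> insert k0 S" for k
      using that c'(2) unfolding sums by (auto simp: B'_def mult.commute)
    moreover have "\<exists>j\<in>J. \<not> d dvd c j"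
      using c'(1) J p(2) prime by (metis c_def insertCI)
    ultimately show ?thesis by blast
  qed
qed

locale ring_map =
  fixes emb :: "'a::comm_ring_1 \<Rightarrow> 'c::comm_ring_1"
  assumes map_1: "emb 1 = 1"
    and map_add: "emb (x + y) = emb x + emb y"
    and map_mult: "emb (x * y) = emb x * emb y"
begin

lemma map_0: "emb 0 = 0"
  using map_add[of 0 0] by simp

lemma map_minus: "emb (- x) = - emb x"
  using map_add[of x "- x"] map_0 by (simp add: eq_neg_iff_add_eq_0 add.commute)

lemma map_sum: "emb (sum f S) = (\<Sum>x\<in>S. emb (f x))"
  by (induction S rule: infinite_finite_induct) (auto simp: map_0 map_add)

lemma map_of_nat: "emb (of_nat n) = of_nat n"
  by (induction n) (auto simp: map_0 map_1 map_add)

lemma submod_0: "submod emb N \<Longrightarrow> 0 \<in> N"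
  and submod_add: "submod emb N \<Longrightarrow> x \<in> N \<Longrightarrow> y \<in> N \<Longrightarrow> x + y \<in> N"
  and submod_mult: "submod emb N \<Longrightarrow> x \<in> N \<Longrightarrow> emb a * x \<in> N"
  unfolding submod_def by auto

lemma submod_minus: "submod emb N \<Longrightarrow> x \<in> N \<Longrightarrow> - x \<in> N"
  using submod_mult[of N x "- 1"] by (simp add: map_minus map_1)

lemma submod_diff: "submod emb N \<Longrightarrow> x \<in> N \<Longrightarrow> y \<in> N \<Longrightarrow> x - y \<in> N"
  using submod_add[of N x "- y"] submod_minus by simp

lemma submod_sum: "submod emb N \<Longrightarrow> (\<And>x. x \<in> S \<Longrightarrow> f x \<in> N) \<Longrightarrow> sum f S \<in> N"
  by (induction S rule: infinite_finite_induct) (auto simp: submod_0 submod_add)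

lemma submod_zero: "submod emb {0}"
  unfolding submod_def by simp

lemma submod_preimage:
  assumes "submod emb N"
  shows "submod emb {x. emb c * x \<in> N}"
  using assms unfolding submod_def by (auto simp: distrib_left mult.left_commute)

lemma indep_mod_subset:
  assumes "submod emb N" "indep_mod emb d N J v" "I \<subseteq> J" "finite J"
  shows "indep_mod emb d N I v"
  unfolding indep_mod_def
proof (intro allI impI ballI)
  fix a j assume a: "(\<Sum>j\<in>I. emb (a j) * v j) \<in> N" and j: "j \<in> I"
  define a' where "a' j = (if j \<in> I then a j else 0)" for j
  have "(\<Sum>j\<in>J. emb (a' j) * v j) = (\<Sum>j\<in>I. emb (a j) * v j)"
    using assms(3,4) by (intro sum.mono_neutral_cong_right) (auto simp: a'_def map_0)
  hence "d dvd a' j" if "j \<in> J" for j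
    using assms(2) a that unfolding indep_mod_def by auto
  from this[of j] show "d dvd a j" using j assms(3) by (auto simp: a'_def)
qed

text \<open>By \<open>dv\<close> and \<open>dy\<close> coefficients matter only modulo
  \<open>d\<close>, so this is linear algebra over a domain. If every \<open>y j\<close> depended on
  \<open>v\<close>, some nontrivial combination of the more numerous \<open>y j\<close> could be
  freed of the \<open>v k\<close> and would lie in \<open>N\<close>.\<close>

lemma steinitz_exchange:
  assumes prime: "\<And>x y. d dvd x * y \<Longrightarrow> d dvd x \<or> d dvd y" and d1: "\<not> d dvd 1"
    and N: "submod emb N"
    and fin: "finite S" "finite J" "card S < card J" "i \<notin> S"
    and v: "indep_mod emb d N S v" and y: "indep_mod emb d N J y"
    and dv: "\<And>k. k \<in> S \<Longrightarrow> emb d * v k \<in> N"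
    and dy: "\<And>j. j \<in> J \<Longrightarrow> emb d * y j \<in> N"
  shows "\<exists>j\<in>J. indep_mod emb d N (insert i S) (v(i := y j))"
proof (rule ccontr)
  assume contr: "\<not> ?thesis"
  have "\<exists>b B. \<not> d dvd b \<and> emb b * y j + (\<Sum>k\<in>S. emb (B k) * v k) \<in> N" if j: "j \<in> J" for j
  proof -
    obtain a where a: "(\<Sum>k\<in>insert i S. emb (a k) * (v(i := y j)) k) \<in> N"
        "\<exists>k\<in>insert i S. \<not> d dvd a k"
      using contr j unfolding indep_mod_def by blast
    have "(\<Sum>k\<in>S. emb (a k) * (v(i := y j)) k) = (\<Sum>k\<in>S. emb (a k) * v k)"
      using fin by (intro sum.cong) auto
    hence *: "emb (a i) * y j + (\<Sum>k\<in>S. emb (a k) * v k) \<in> N"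
      using a(1) fin by simp
    \<comment> \<open>Otherwise the \<open>y j\<close> term lies in \<open>N\<close>, which leaves a
      relation among the \<open>v k\<close> alone.\<close>
    have "\<not> d dvd a i"
    proof
      assume "d dvd a i"
      then obtain b where "a i = d * b" by blast
      hence "emb (a i) * y j \<in> N"
        using submod_mult[OF N dy[OF j], of b] by (simp add: map_mult ac_simps)
      hence "(\<Sum>k\<in>S. emb (a k) * v k) \<in> N"
        using submod_diff[OF N *] by fastforce
      thus False using v a(2) \<open>d dvd a i\<close> unfolding indep_mod_def by auto
    qed
    thus ?thesis using * by blast
  qed
  then obtain b B where b: "\<And>j. j \<in> J \<Longrightarrow> \<not> d dvd b j"
    and B: "\<And>j. j \<in> J \<Longrightarrow> emb (b j) * y j + (\<Sum>k\<in>S. emb (B j k) * v k) \<in> N"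
    by metis
  obtain c where c: "\<exists>j\<in>J. \<not> d dvd c j" "\<forall>k\<in>S. d dvd (\<Sum>j\<in>J. c j * B j k)"
    using linear_system_mod_prime[OF prime d1 fin(1-3)] by blast
  have "(\<Sum>j\<in>J. emb (c j) * (emb (b j) * y j + (\<Sum>k\<in>S. emb (B j k) * v k))) \<in> N"
    by (intro submod_sum submod_mult N B)
  also have "(\<Sum>j\<in>J. emb (c j) * (emb (b j) * y j + (\<Sum>k\<in>S. emb (B j k) * v k))) =
      (\<Sum>j\<in>J. emb (c j * b j) * y j) + (\<Sum>j\<in>J. \<Sum>k\<in>S. emb (c j * B j k) * v k)"
    by (simp add: map_mult algebra_simps sum.distrib sum_distrib_left)
  also have "(\<Sum>j\<in>J. \<Sum>k\<in>S. emb (c j * B j k) * v k) =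
      (\<Sum>k\<in>S. emb (\<Sum>j\<in>J. c j * B j k) * v k)"
    by (subst sum.swap) (simp add: map_sum sum_distrib_right)
  finally have *: "(\<Sum>j\<in>J. emb (c j * b j) * y j) +
      (\<Sum>k\<in>S. emb (\<Sum>j\<in>J. c j * B j k) * v k) \<in> N" .
  have "(\<Sum>k\<in>S. emb (\<Sum>j\<in>J. c j * B j k) * v k) \<in> N"
  proof (intro submod_sum N)
    fix k assume k: "k \<in> S"
    then obtain e where "(\<Sum>j\<in>J. c j * B j k) = d * e" using c(2) by blast
    thus "emb (\<Sum>j\<in>J. c j * B j k) * v k \<in> N"
      using submod_mult[OF N dv[OF k], of e] by (simp add: map_mult ac_simps)
  qed
  hence "(\<Sum>j\<in>J. emb (c j * b j) * y j) \<in> N"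
    using submod_diff[OF N *] by fastforce
  hence "d dvd c j * b j" if "j \<in> J" for j
    using y[unfolded indep_mod_def, rule_format, of "\<lambda>j. c j * b j"] that by blast
  thus False using c(1) b prime by blast
qed

text \<open>Exchange needs a prime modulus; enlarging \<open>N\<close> by division by
  \<open>u ^ (n - 1)\<close> trades \<open>u ^ n\<close> for \<open>u\<close>. One direction
  multiplies the coefficients by \<open>u ^ (n - 1)\<close>, the other extracts one factor
  \<open>u\<close> at a time.\<close>

lemma indep_mod_power_iff:
  fixes u :: 'a
  assumes N: "submod emb N" and n: "n > 0" and u: "\<And>x y m. u ^ m * x = u ^ m * y \<Longrightarrow> x = y"
  shows "indep_mod emb (u ^ n) N J z \<longleftrightarrow> indep_mod emb u {x. emb (u ^ (n - 1)) * x \<in> N} J z"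
proof
  assume L: "indep_mod emb (u ^ n) N J z"
  show "indep_mod emb u {x. emb (u ^ (n - 1)) * x \<in> N} J z"
    unfolding indep_mod_def
  proof (intro allI impI ballI)
    fix a j assume "(\<Sum>j\<in>J. emb (a j) * z j) \<in> {x. emb (u ^ (n - 1)) * x \<in> N}" and j: "j \<in> J"
    hence "(\<Sum>j\<in>J. emb (u ^ (n - 1) * a j) * z j) \<in> N"
      by (simp add: sum_distrib_left map_mult ac_simps)
    hence "u ^ n dvd u ^ (n - 1) * a j"
      using L[unfolded indep_mod_def, rule_format, of "\<lambda>j. u ^ (n - 1) * a j"] j by blast
    then obtain e where "u ^ (n - 1) * a j = u ^ n * e" by blast
    also have "\<dots> = u ^ (n - 1) * (u * e)"
      using n by (cases n) (auto simp: ac_simps)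
    finally show "u dvd a j" using u by fastforce
  qed
next
  assume R: "indep_mod emb u {x. emb (u ^ (n - 1)) * x \<in> N} J z"
  show "indep_mod emb (u ^ n) N J z"
    unfolding indep_mod_def
  proof (intro allI impI)
    fix a assume a: "(\<Sum>j\<in>J. emb (a j) * z j) \<in> N"
    have "\<forall>j\<in>J. u ^ s dvd a j" if "s \<le> n" for s
      using that
    proof (induction s)
      case (Suc s)
      then obtain b where b: "\<And>j. j \<in> J \<Longrightarrow> a j = u ^ s * b j"
        using Suc_leD unfolding dvd_def by metis
      \<comment> \<open>Together with the \<open>u ^ s\<close> already extracted, this power makes
        exactly \<open>u ^ (n - 1)\<close>.\<close>
      have "emb (u ^ (n - 1 - s)) * (\<Sum>j\<in>J. emb (a j) * z j) \<in> N"
        using submod_mult[OF N a] .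
      also have "emb (u ^ (n - 1 - s)) * (\<Sum>j\<in>J. emb (a j) * z j) =
          (\<Sum>j\<in>J. emb (u ^ (n - 1 - s) * u ^ s) * (emb (b j) * z j))"
        unfolding sum_distrib_left by (intro sum.cong) (auto simp: b map_mult ac_simps)
      also have "u ^ (n - 1 - s) * u ^ s = u ^ (n - 1)"
        using Suc.prems by (simp add: power_add[symmetric])
      finally have "(\<Sum>j\<in>J. emb (b j) * z j) \<in> {x. emb (u ^ (n - 1)) * x \<in> N}"
        by (simp add: sum_distrib_left)
      hence "\<forall>j\<in>J. u dvd b j" using R unfolding indep_mod_def by blast
      thus ?case using b by (auto simp: power_Suc2 simp del: power_Suc intro!: mult_dvd_mono)
    qed auto
    thus "\<forall>j\<in>J. u ^ n dvd a j" by blast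
  qed
qed

end

lemma A_independent_iff_indep_mod: "A_independent emb i v \<longleftrightarrow> indep_mod emb 0 {0} {1..i} v"
  unfolding A_independent_def indep_mod_def by simp

section \<open>The exponential function of a lattice\<close>

text \<open>For fixed \<open>y\<close>, the defect p(X + y) - p(X) - p(y) has degree below
  \<open>card V\<close> because the leading terms cancel, yet it vanishes on all of
  \<open>V\<close>.\<close>

lemma prod_subgroup_additive:
  fixes V :: "'c::field set"
  assumes "finite V" "0 \<in> V" "\<And>x y. x \<in> V \<Longrightarrow> y \<in> V \<Longrightarrow> x - y \<in> V"
  shows "(\<Prod>v\<in>V. x + y - v) = (\<Prod>v\<in>V. x - v) + (\<Prod>v\<in>V. y - v)"
proof -
  define p where "p = (\<Prod>v\<in>V. [:- v, 1:])"
  have poly_p: "poly p z = (\<Prod>v\<in>V. z - v)" for z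
    by (simp add: p_def poly_prod)
  have deg: "degree p = card V"
    unfolding p_def by (subst degree_prod_sum_eq) auto
  have lead: "lead_coeff p = 1"
    unfolding p_def by (simp add: lead_coeff_prod)
  have pos: "card V > 0" using assms card_gt_0_iff by blast
  have add: "a + b \<in> V" if "a \<in> V" "b \<in> V" for a b
    using assms(3)[OF that(1) assms(3)[OF assms(2) that(2)]] by simp
  define f where "f = pcompose p [:y, 1:] - p - [:poly p y:]"
  have "degree (pcompose p [:y, 1:]) = card V"
    by (simp add: degree_pcompose deg)
  moreover have "lead_coeff (pcompose p [:y, 1:]) = 1"
    by (subst lead_coeff_comp) (auto simp: lead)
  ultimately have "coeff f (card V) = 0"
    using lead deg pos by (simp add: f_def coeff_pCons split: nat.split)
  moreover have "degree f \<le> card V"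
    unfolding f_def by (intro degree_diff_le) (auto simp: degree_pcompose deg)
  ultimately have degf: "f = 0 \<or> degree f < card V"
    by (metis le_neq_implies_less leading_coeff_0_iff)
  have "poly f v = 0" if v: "v \<in> V" for v
  proof -
    \<comment> \<open>Translation by \<open>v\<close> permutes \<open>V\<close>.\<close>
    have "(\<Prod>x\<in>V. y + v - x) = (\<Prod>x\<in>V. y - x)"
      using v assms(3) add
      by (intro prod.reindex_bij_witness[of _ "\<lambda>x. x + v" "\<lambda>x. x - v"]) (auto simp: algebra_simps)
    moreover have "(\<Prod>x\<in>V. v - x) = 0" using v assms(1) by auto
    ultimately show ?thesis by (simp add: f_def poly_pcompose poly_p)
  qed
  hence "V \<subseteq> {x. poly f x = 0}" by blast
  have "f = 0"
  proof (rule ccontr)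
    assume "f \<noteq> 0"
    hence "card V \<le> degree f"
      using card_mono[OF poly_roots_finite \<open>V \<subseteq> _\<close>] card_poly_roots_bound[of f] by force
    thus False using degf \<open>f \<noteq> 0\<close> by simp
  qed
  hence "poly f x = 0" by simp
  thus ?thesis by (simp add: f_def poly_pcompose poly_p algebra_simps)
qed

text \<open>Normalizing the factors only rescales the product over \<open>V\<close> by the constant
  \<open>c\<close>; the element 0 of \<open>V\<close> accounts for the factor in front.\<close>

lemma prod_subgroup_normalized_additive:
  fixes V :: "'c::field set"
  assumes "finite V" "0 \<in> V" "\<And>x y. x \<in> V \<Longrightarrow> y \<in> V \<Longrightarrow> x - y \<in> V"
  shows "(x + y) * (\<Prod>v\<in>V-{0}. 1 - (x + y) / v) =
    x * (\<Prod>v\<in>V-{0}. 1 - x / v) + y * (\<Prod>v\<in>V-{0}. 1 - y / v)"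
proof -
  define c where "c = (\<Prod>v\<in>V-{0}. - inverse v)"
  have "z * (\<Prod>v\<in>V-{0}. 1 - z / v) = c * (\<Prod>v\<in>V. z - v)" for z
  proof -
    have "(\<Prod>v\<in>V-{0}. 1 - z / v) = (\<Prod>v\<in>V-{0}. - inverse v * (z - v))"
      by (intro prod.cong) (auto simp: field_simps)
    also have "\<dots> = c * (\<Prod>v\<in>V-{0}. z - v)"
      unfolding c_def by (rule prod.distrib)
    finally show ?thesis
      using assms(1,2) by (simp add: prod.remove[of V 0])
  qed
  thus ?thesis using prod_subgroup_additive[OF assms] by (simp add: distrib_left)
qed

sublocale infinite_completion \<subseteq> ring_map emb
  by unfold_locales (auto simp: emb_1 emb_add emb_mult)

context infinite_completion
begin

section \<open>Ultrametric absolute values\<close>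

lemma absv_nonneg [simp]: "absv x \<ge> 0" and absv_0 [simp]: "absv 0 = 0"
  and absv_eq_0 [simp]: "absv x = 0 \<longleftrightarrow> x = 0" for x :: 'c
  by (auto simp: absv_def)

lemma absv_pos [simp]: "absv x > 0 \<longleftrightarrow> x \<noteq> 0" for x :: 'c
  by (auto simp: absv_def)

lemma absv_1 [simp]: "absv (1::'c) = 1"
  using absv_emb[of 1] by (simp add: emb_1)

lemma absv_minus [simp]: "absv (- x) = absv x" for x :: 'c
  using dist_absv[of 0 x] by (simp add: absv_def dist_commute)

lemma absv_minus_commute: "absv (x - y) = absv (y - x)" for x y :: 'c
  using absv_minus[of "x - y"] by simp

lemma absv_diff_le: "absv (x - y) \<le> max (absv x) (absv y)" for x y :: 'c
  using absv_ultrametric[of x "- y"] by simp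

lemma absv_inverse: "absv (inverse x) = inverse (absv x)" for x :: 'c
proof (cases "x = 0")
  case False
  hence "absv x * absv (inverse x) = 1" by (simp flip: absv_mult)
  thus ?thesis by (simp add: inverse_unique)
qed auto

lemma absv_divide: "absv (x / y) = absv x / absv y" for x y :: 'c
  by (simp add: divide_inverse absv_mult absv_inverse)

lemma absv_prod: "absv (prod f S) = (\<Prod>x\<in>S. absv (f x))" for f :: "'b \<Rightarrow> 'c"
  by (induction S rule: infinite_finite_induct) (auto simp: absv_mult)

lemma absv_sum_less: "b > 0 \<Longrightarrow> (\<And>x. x \<in> S \<Longrightarrow> absv (f x) < b) \<Longrightarrow> absv (sum f S) < b"
  for f :: "'b \<Rightarrow> 'c"
proof (induction S rule: infinite_finite_induct)
  case (insert x S)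
  thus ?case using absv_ultrametric[of "f x" "sum f S"] by fastforce
qed auto

lemma absv_one_minus: "absv x < 1 \<Longrightarrow> absv (1 - x) = 1" for x :: 'c
  using absv_diff_le[of 1 x] absv_ultrametric[of "1 - x" x] by auto

lemma absv_diff_abs_le: "\<bar>absv x - absv y\<bar> \<le> absv (x - y)" for x y :: 'c
  using abs_dist_diff_le[of x 0 y] dist_absv[of x y] by (simp add: absv_def dist_commute)

text \<open>Partial products have absolute value at most 1, so in an ultrametric the errors of the
  factors do not accumulate.\<close>

lemma absv_prod_minus_1_le:
  fixes f :: "'b \<Rightarrow> 'c"
  assumes "0 \<le> e" "e \<le> 1" "\<And>x. x \<in> S \<Longrightarrow> absv (f x) \<le> e"
  shows "absv ((\<Prod>x\<in>S. 1 - f x) - 1) \<le> e"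
  using assms(3)
proof (induction S rule: infinite_finite_induct)
  case (insert x S)
  define P where "P = (\<Prod>x\<in>S. 1 - f x)"
  have P: "absv (P - 1) \<le> e" using insert unfolding P_def by auto
  hence "absv P \<le> 1" using absv_ultrametric[of "P - 1" 1] assms(2) by auto
  hence "absv (f x * P) \<le> e * 1"
    unfolding absv_mult using insert.prems assms(1) by (intro mult_mono) auto
  moreover have "(\<Prod>x\<in>insert x S. 1 - f x) - 1 = (P - 1) - f x * P"
    using insert by (simp add: P_def algebra_simps)
  ultimately show ?case using absv_diff_le[of "P - 1" "f x * P"] P
    by (metis max.boundedI mult_1_right order_trans)
qed (use assms in auto)

lemma CARD_gt_1: "real CARD('k) > 1"
proof -
  have "card {0, 1 :: 'k} \<le> CARD('k)" by (rule card_mono) auto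
  thus ?thesis by simp
qed

lemma absv_emb_less: "degree a < degree b \<Longrightarrow> absv (emb a) < absv (emb b)"
  using absv_emb[of a] absv_emb[of b] CARD_gt_1
  by (cases "a = 0"; cases "b = 0") (auto simp: map_0)

lemma emb_eq_0 [simp]: "emb a = 0 \<longleftrightarrow> a = 0"
proof (cases "a = 0")
  case False
  hence "absv (emb a) > 0" using absv_emb[of a] CARD_gt_1 by simp
  thus ?thesis using False by auto
qed (simp add: map_0)

section \<open>Convergence and additivity of the lattice product\<close>

definition lattice_ball :: "'c set \<Rightarrow> nat \<Rightarrow> 'c set" where
  "lattice_ball \<Lambda> N = {x \<in> \<Lambda>. absv x \<le> real N}"

text \<open>Lattice vectors longer than \<open>z\<close> give factors of absolute value 1, so the
  products over balls of radius above |z| all have absolute value \<open>M\<close>. Factors outside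
  the ball differ from 1 by at most |z|/N. Arbitrary finite \<open>S\<close> occur because
  \<open>lattice_exp\<close> is a limit over finite subsets.\<close>

lemma lattice_product_Cauchy:
  fixes \<Lambda> :: "'c set"
  assumes fin: "\<And>R. finite {x \<in> \<Lambda>. absv x \<le> R}" and e: "e > 0"
  shows "\<exists>N0. \<forall>N\<ge>N0. \<forall>S. finite S \<longrightarrow> lattice_ball \<Lambda> N - {0} \<subseteq> S \<longrightarrow> S \<subseteq> \<Lambda> - {0} \<longrightarrow>
    absv ((\<Prod>\<mu>\<in>S. 1 - z / \<mu>) - (\<Prod>\<mu>\<in>lattice_ball \<Lambda> N - {0}. 1 - z / \<mu>)) < e"
proof -
  define P where "P S = (\<Prod>\<mu>\<in>S. 1 - z / \<mu>)" for S
  define S0 where "S0 = {x \<in> \<Lambda>. absv x \<le> absv z} - {0}"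
  define M where "M = absv (P S0)"
  \<comment> \<open>For \<open>N\<close> from here on, both |z| < N and |z| M / N < e.\<close>
  define N0 where "N0 = nat \<lceil>max (absv z) (absv z * (M + 1) / e) + 1\<rceil>"
  have M: "M \<ge> 0" by (simp add: M_def)
  have "absv (P S - P (lattice_ball \<Lambda> N - {0})) < e"
    if N: "N \<ge> N0" and S: "finite S" "lattice_ball \<Lambda> N - {0} \<subseteq> S" "S \<subseteq> \<Lambda> - {0}" for N S
  proof -
    define T where "T = lattice_ball \<Lambda> N - {0}"
    have "real N \<ge> max (absv z) (absv z * (M + 1) / e) + 1"
      using N unfolding N0_def by linarith
    hence Nz: "real N > absv z" and "real N > absv z * (M + 1) / e" by auto
    hence "absv z * (M + 1) < e * real N" using e by (simp add: field_simps)
    have Npos: "real N > 0" using Nz absv_nonneg[of z] by linarith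
    have T: "finite T" "S0 \<subseteq> T"
      using fin[of N] Nz by (auto simp: T_def lattice_ball_def S0_def)
    have small: "absv (z / \<mu>) \<le> absv z / real N" if "\<mu> \<in> S - T" for \<mu>
    proof -
      have "absv \<mu> > real N" using that S by (auto simp: T_def lattice_ball_def)
      thus ?thesis using Npos by (simp add: absv_divide frac_le)
    qed
    have "P T = P S0 * P (T - S0)"
      using prod.subset_diff[OF T(2,1)] by (simp add: P_def mult.commute)
    moreover have "absv (P (T - S0)) = 1"
      unfolding P_def absv_prod
    proof (intro prod.neutral ballI absv_one_minus)
      fix \<mu> assume "\<mu> \<in> T - S0"
      hence "absv z < absv \<mu>" by (auto simp: T_def S0_def lattice_ball_def)
      thus "absv (z / \<mu>) < 1" by (simp add: absv_divide divide_less_eq)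
    qed
    ultimately have PT: "absv (P T) = M" by (simp add: absv_mult M_def)
    have "P S = P T * P (S - T)"
      using prod.subset_diff[of T S] S by (simp add: T_def P_def mult.commute)
    hence "P S - P T = P T * (P (S - T) - 1)" by (simp add: algebra_simps)
    hence "absv (P S - P T) = M * absv (P (S - T) - 1)" by (simp add: absv_mult PT)
    also have "\<dots> \<le> M * (absv z / real N)"
      unfolding P_def using M small Nz Npos
      by (intro mult_left_mono absv_prod_minus_1_le) auto
    also have "\<dots> \<le> absv z * (M + 1) / real N"
      using Npos by (simp add: field_simps)
    also have "\<dots> < e" using \<open>absv z * (M + 1) < e * real N\<close> Npos by (simp add: field_simps)
    finally show ?thesis unfolding T_def .
  qed
  thus ?thesis unfolding P_def by blast
qed

text \<open>The value of \<open>Lim\<close> carries information only once convergence is known: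
  completeness gives a limit along the balls, and the Cauchy estimate extends it to all finite
  subsets.\<close>

lemma lattice_exp_limit:
  fixes \<Lambda> :: "'c set"
  assumes fin: "\<And>R. finite {x \<in> \<Lambda>. absv x \<le> R}" and e: "e > 0"
  shows "\<exists>N0. \<forall>N\<ge>N0.
    absv (z * (\<Prod>\<mu>\<in>lattice_ball \<Lambda> N - {0}. 1 - z / \<mu>) - lattice_exp \<Lambda> z) < e"
proof -
  define P where "P S = (\<Prod>\<mu>\<in>S. 1 - z / \<mu>)" for S
  define T where "T N = lattice_ball \<Lambda> N - {0}" for N
  have T: "finite (T N)" "T N \<subseteq> \<Lambda> - {0}" for N
    using fin[of N] by (auto simp: T_def lattice_ball_def)
  have Tmono: "T M \<subseteq> T N" if "M \<le> N" for M N
    using that by (auto simp: T_def lattice_ball_def)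
  have C: "\<exists>N0. \<forall>N\<ge>N0. \<forall>S. finite S \<longrightarrow> T N \<subseteq> S \<longrightarrow> S \<subseteq> \<Lambda> - {0} \<longrightarrow>
      absv (P S - P (T N)) < e" if "e > 0" for e
    using lattice_product_Cauchy[OF fin that, of z] unfolding P_def T_def .
  have "Cauchy (\<lambda>N. P (T N))"
  proof (rule metric_CauchyI)
    fix e :: real assume "e > 0"
    hence "e / 2 > 0" by simp
    from C[OF this] obtain N0 where N0: "\<And>N S. N \<ge> N0 \<Longrightarrow> finite S \<Longrightarrow> T N \<subseteq> S \<Longrightarrow>
        S \<subseteq> \<Lambda> - {0} \<Longrightarrow> absv (P S - P (T N)) < e / 2"
      by blast
    have "dist (P (T m)) (P (T N0)) < e / 2" if "m \<ge> N0" for m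
      using N0[of N0 "T m"] T Tmono that by (auto simp: dist_absv)
    thus "\<exists>M. \<forall>m\<ge>M. \<forall>n\<ge>M. dist (P (T m)) (P (T n)) < e"
      by (meson dist_triangle_half_l)
  qed
  then obtain L where L: "(\<lambda>N. P (T N)) \<longlonglongrightarrow> L"
    using Cauchy_convergent convergent_def by blast
  have "(P \<longlongrightarrow> L) (finite_subsets_at_top (\<Lambda> - {0}))"
  proof (rule tendstoI)
    fix e :: real assume e: "e > 0"
    hence e2: "e / 2 > 0" by simp
    from C[OF this] obtain N0 where N0: "\<And>N S. N \<ge> N0 \<Longrightarrow> finite S \<Longrightarrow> T N \<subseteq> S \<Longrightarrow>
        S \<subseteq> \<Lambda> - {0} \<Longrightarrow> absv (P S - P (T N)) < e / 2"
      by blast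
    obtain N1 where N1: "\<And>N. N \<ge> N1 \<Longrightarrow> dist (P (T N)) L < e / 2"
      using metric_LIMSEQ_D[OF L e2] by blast
    define N where "N = max N0 N1"
    have "dist (P S) L < e" if "finite S" "T N \<subseteq> S" "S \<subseteq> \<Lambda> - {0}" for S
    proof -
      have "dist (P S) (P (T N)) < e / 2"
        using N0[of N S] that by (simp add: N_def dist_absv)
      thus ?thesis using N1[of N] dist_triangle[of "P S" L "P (T N)"] by (simp add: N_def)
    qed
    thus "\<forall>\<^sub>F S in finite_subsets_at_top (\<Lambda> - {0}). dist (P S) L < e"
      unfolding eventually_finite_subsets_at_top using T by metis
  qed
  hence "Lim (finite_subsets_at_top (\<Lambda> - {0})) P = L"
    by (intro tendsto_Lim) auto
  hence E: "lattice_exp \<Lambda> z = z * L"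
    by (simp add: lattice_exp_def P_def[abs_def])
  define e' where "e' = e / (absv z + 1)"
  have z1: "absv z + 1 > 0" using absv_nonneg[of z] by linarith
  have "e' > 0" using e z1 by (simp add: e'_def)
  then obtain N1 where N1: "\<And>N. N \<ge> N1 \<Longrightarrow> dist (P (T N)) L < e'"
    using metric_LIMSEQ_D[OF L] by blast
  have "absv (z * P (T N) - lattice_exp \<Lambda> z) < e" if "N \<ge> N1" for N
  proof -
    have "absv (z * P (T N) - lattice_exp \<Lambda> z) = absv z * dist (P (T N)) L"
      by (simp add: E dist_absv flip: absv_mult right_diff_distrib)
    also have "\<dots> \<le> absv z * e'"
      using N1[OF that] by (intro mult_left_mono) auto
    also have "\<dots> < (absv z + 1) * e'" using \<open>e' > 0\<close> by (simp add: distrib_right)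
    also have "\<dots> = e" using z1 by (simp add: e'_def)
    finally show ?thesis .
  qed
  thus ?thesis unfolding P_def T_def by blast
qed

text \<open>By the ultrametric inequality each ball in \<Lambda> is a finite subgroup, so the
  partial products \<open>Q N\<close> are additive, and the limit inherits this.\<close>

lemma lattice_exp_additive:
  fixes \<Lambda> :: "'c set"
  assumes fin: "\<And>R. finite {x \<in> \<Lambda>. absv x \<le> R}" and sub: "submod emb \<Lambda>"
  shows "lattice_exp \<Lambda> (x + y) = lattice_exp \<Lambda> x + lattice_exp \<Lambda> y"
proof -
  define Q where "Q N z = z * (\<Prod>\<mu>\<in>lattice_ball \<Lambda> N - {0}. 1 - z / \<mu>)" for N and z :: 'c
  have Q_add: "Q N (x + y) = Q N x + Q N y" for N
    unfolding Q_def
  proof (rule prod_subgroup_normalized_additive)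
    show "a - b \<in> lattice_ball \<Lambda> N" if "a \<in> lattice_ball \<Lambda> N" "b \<in> lattice_ball \<Lambda> N" for a b
      using that absv_diff_le[of a b] submod_diff[OF sub] by (auto simp: lattice_ball_def)
  qed (use fin submod_0[OF sub] in \<open>auto simp: lattice_ball_def\<close>)
  have "absv (lattice_exp \<Lambda> (x + y) - (lattice_exp \<Lambda> x + lattice_exp \<Lambda> y)) < e" if "e > 0" for e
  proof -
    have lim: "\<exists>N0. \<forall>N\<ge>N0. absv (Q N z - lattice_exp \<Lambda> z) < e" for z
      unfolding Q_def by (rule lattice_exp_limit[OF fin that])
    obtain N1 N2 N3 where "\<forall>N\<ge>N1. absv (Q N x - lattice_exp \<Lambda> x) < e"
      "\<forall>N\<ge>N2. absv (Q N y - lattice_exp \<Lambda> y) < e"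
      "\<forall>N\<ge>N3. absv (Q N (x + y) - lattice_exp \<Lambda> (x + y)) < e"
      using lim by meson
    moreover define N where "N = max N1 (max N2 N3)"
    ultimately have N: "absv (Q N x - lattice_exp \<Lambda> x) < e" "absv (Q N y - lattice_exp \<Lambda> y) < e"
      "absv (Q N (x + y) - lattice_exp \<Lambda> (x + y)) < e" by auto
    have "absv ((Q N x - lattice_exp \<Lambda> x) + (Q N y - lattice_exp \<Lambda> y)) < e"
      using absv_ultrametric[of "Q N x - lattice_exp \<Lambda> x" "Q N y - lattice_exp \<Lambda> y"] N by simp
    hence "absv ((Q N x - lattice_exp \<Lambda> x) + (Q N y - lattice_exp \<Lambda> y) -
        (Q N (x + y) - lattice_exp \<Lambda> (x + y))) < e"
      using absv_diff_le[of "(Q N x - lattice_exp \<Lambda> x) + (Q N y - lattice_exp \<Lambda> y)"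
          "Q N (x + y) - lattice_exp \<Lambda> (x + y)"] N by simp
    thus ?thesis by (simp add: Q_add algebra_simps)
  qed
  \<comment> \<open>Taking the size of the defect itself for \<open>e\<close> forces the defect to
    be 0.\<close>
  from this[of "absv (lattice_exp \<Lambda> (x + y) - (lattice_exp \<Lambda> x + lattice_exp \<Lambda> y))"]
  show ?thesis by (metis absv_pos eq_iff_diff_eq_0 less_irrefl)
qed

section \<open>Absolute values of exponentials\<close>

lemma absv_lattice_exp_approx:
  fixes \<Lambda> :: "'c set"
  assumes fin: "\<And>R. finite {x \<in> \<Lambda>. absv x \<le> R}" and "e > 0"
  shows "\<exists>N. \<bar>absv z * (\<Prod>\<mu>\<in>lattice_ball \<Lambda> N - {0}. absv (1 - z / \<mu>)) -
    absv (lattice_exp \<Lambda> z)\<bar> < e"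
proof -
  obtain N where "absv (z * (\<Prod>\<mu>\<in>lattice_ball \<Lambda> N - {0}. 1 - z / \<mu>) - lattice_exp \<Lambda> z) < e"
    using lattice_exp_limit[OF assms, of z] by blast
  hence "\<bar>absv (z * (\<Prod>\<mu>\<in>lattice_ball \<Lambda> N - {0}. 1 - z / \<mu>)) - absv (lattice_exp \<Lambda> z)\<bar> < e"
    using absv_diff_abs_le le_less_trans by blast
  thus ?thesis by (auto simp: absv_mult absv_prod)
qed

lemma absv_lattice_exp_small:
  fixes \<Lambda> :: "'c set"
  assumes fin: "\<And>R. finite {x \<in> \<Lambda>. absv x \<le> R}"
    and small: "\<And>\<mu>. \<mu> \<in> \<Lambda> - {0} \<Longrightarrow> absv z < absv \<mu>"
  shows "absv (lattice_exp \<Lambda> z) = absv z"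
proof -
  have "(\<Prod>\<mu>\<in>lattice_ball \<Lambda> N - {0}. absv (1 - z / \<mu>)) = 1" for N
  proof (intro prod.neutral ballI absv_one_minus)
    fix \<mu> assume "\<mu> \<in> lattice_ball \<Lambda> N - {0}"
    hence "absv z < absv \<mu>" using small by (auto simp: lattice_ball_def)
    thus "absv (z / \<mu>) < 1" by (simp add: absv_divide divide_less_eq)
  qed
  hence "\<bar>absv z - absv (lattice_exp \<Lambda> z)\<bar> < e" if "e > 0" for e
    using absv_lattice_exp_approx[OF fin that, of z] by simp
  from this[of "\<bar>absv z - absv (lattice_exp \<Lambda> z)\<bar>"] show ?thesis by fastforce
qed

text \<open>Shortness of \<open>z\<close> in its coset gives |\<mu>| <= max(|z|, |z - \<mu>|) = |z -
  \<mu>|, so no factor 1 - z/\<mu> has absolute value below 1.\<close>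

lemma absv_lattice_exp_reduced:
  fixes \<Lambda> :: "'c set"
  assumes fin: "\<And>R. finite {x \<in> \<Lambda>. absv x \<le> R}"
    and red: "\<And>\<mu>. \<mu> \<in> \<Lambda> \<Longrightarrow> absv z \<le> absv (z - \<mu>)"
  shows "absv (lattice_exp \<Lambda> z) \<ge> absv z"
proof -
  have "(\<Prod>\<mu>\<in>lattice_ball \<Lambda> N - {0}. absv (1 - z / \<mu>)) \<ge> 1" for N
  proof (intro prod_ge_1)
    fix \<mu> assume \<mu>: "\<mu> \<in> lattice_ball \<Lambda> N - {0}"
    hence "absv z \<le> absv (z - \<mu>)" using red by (auto simp: lattice_ball_def)
    moreover have "absv \<mu> \<le> max (absv z) (absv (z - \<mu>))"
      using absv_diff_le[of z "z - \<mu>"] by simp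
    ultimately have "absv \<mu> \<le> absv (\<mu> - z)" by (simp add: absv_minus_commute)
    moreover have "1 - z / \<mu> = (\<mu> - z) / \<mu>" using \<mu> by (simp add: diff_divide_distrib)
    ultimately show "1 \<le> absv (1 - z / \<mu>)" using \<mu> by (simp add: absv_divide)
  qed
  hence "absv z \<le> absv z * (\<Prod>\<mu>\<in>lattice_ball \<Lambda> N - {0}. absv (1 - z / \<mu>))" for N
    using mult_left_mono[of 1 "\<Prod>\<mu>\<in>lattice_ball \<Lambda> N - {0}. absv (1 - z / \<mu>)" "absv z"] by simp
  hence "absv z \<le> absv (lattice_exp \<Lambda> z) + e" if "e > 0" for e
    using absv_lattice_exp_approx[OF fin that, of z] by (smt (verit))
  thus ?thesis by (rule field_le_epsilon)
qed

text \<open>Subtracting a lattice vector longer than \<open>z\<close> only lengthens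
  \<open>z\<close>, so the minimum is sought among finitely many vectors.\<close>

lemma reduced_representative:
  fixes \<Lambda> :: "'c set"
  assumes fin: "\<And>R. finite {x \<in> \<Lambda>. absv x \<le> R}" and sub: "submod emb \<Lambda>"
  shows "\<exists>\<nu>\<in>\<Lambda>. \<forall>\<mu>\<in>\<Lambda>. absv (z - \<nu>) \<le> absv (z - \<nu> - \<mu>)"
proof -
  define V where "V = {x \<in> \<Lambda>. absv x \<le> absv z}"
  have "finite V" "0 \<in> V" using fin submod_0[OF sub] by (auto simp: V_def)
  then obtain \<nu> where \<nu>: "\<nu> \<in> V" "\<And>x. x \<in> V \<Longrightarrow> absv (z - \<nu>) \<le> absv (z - x)"
    using arg_min_if_finite(1)[of V "\<lambda>x. absv (z - x)"] arg_min_least[of V _ "\<lambda>x. absv (z - x)"]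
    by (metis empty_iff)
  have "absv (z - \<nu>) \<le> absv (z - x)" if x: "x \<in> \<Lambda>" for x
  proof (cases "x \<in> V")
    case False
    hence "absv z < absv x" using x by (auto simp: V_def)
    hence "absv z < absv (z - x)"
      using absv_diff_le[of z "z - x"] by auto
    thus ?thesis using \<nu>(2)[OF \<open>0 \<in> V\<close>] by simp
  qed (use \<nu> in auto)
  thus ?thesis using \<nu>(1) submod_add[OF sub]
    by (metis (no_types, lifting) V_def diff_diff_eq mem_Collect_eq)
qed

section \<open>Comparison of valuations, and independence over A\<close>

lemma w_ext_le_imp_absv_le:
  assumes "w_ext emb w x \<le> w_ext emb w y"
  shows "absv y \<le> absv x"
proof -
  obtain e where "e > 0" and e: "\<And>a b. a \<noteq> 0 \<Longrightarrow> b \<noteq> 0 \<Longrightarrow>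
      w (emb a / emb b) = e * (int (degree b) - int (degree a))"
    using prime unfolding infinite_prime_def by blast
  have "w (emb [:0, 1:]) = - e"
    using e[of "[:0, 1:]" 1] by (simp add: emb_1)
  hence "real_of_int (ramification_index emb w) > 0"
    using \<open>e > 0\<close> by (simp add: ramification_index_def)
  thus ?thesis using assms CARD_gt_1
    by (cases "x = 0"; cases "y = 0") (auto simp: w_ext_def)
qed

text \<open>Descent: a relation has coefficients divisible by \<open>m\<close> and can be divided by
  \<open>m\<close>, so they are divisible by every power of \<open>m\<close>. Degrees then force
  them to be 0.\<close>

lemma indep_mod_imp_A_independent:
  assumes N: "submod emb N" and "indep_mod emb m N {1..i} v" "degree m > 0"
  shows "A_independent emb i v"
  unfolding A_independent_def
proof (intro allI impI ballI)
  fix a j assume a: "(\<Sum>j=1..i. emb (a j) * v j) = 0" and j: "j \<in> {1..i}"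
  have pow: "\<forall>j\<in>{1..i}. m ^ s dvd a j" if "(\<Sum>j=1..i. emb (a j) * v j) = 0" for s a
    using that
  proof (induction s arbitrary: a)
    case (Suc s)
    hence "\<forall>j\<in>{1..i}. m dvd a j"
      using assms(2) submod_0[OF N] unfolding indep_mod_def by simp
    then obtain b where b: "\<And>j. j \<in> {1..i} \<Longrightarrow> a j = m * b j"
      unfolding dvd_def by metis
    have "emb m * (\<Sum>j=1..i. emb (b j) * v j) = (\<Sum>j=1..i. emb (a j) * v j)"
      unfolding sum_distrib_left by (intro sum.cong) (auto simp: b emb_mult ac_simps)
    moreover have "m \<noteq> 0" using assms(3) by auto
    ultimately have "(\<Sum>j=1..i. emb (b j) * v j) = 0" using Suc.prems by simp
    from Suc.IH[OF this] show ?case using b by simp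
  qed simp
  show "a j = 0"
  proof (rule ccontr)
    assume "a j \<noteq> 0"
    hence "degree (m ^ Suc (degree (a j))) \<le> degree (a j)"
      using pow[OF a, of "Suc (degree (a j))"] j by (intro dvd_imp_degree_le) auto
    moreover have "degree (m ^ Suc (degree (a j))) = Suc (degree (a j)) * degree m"
      using assms(3) by (subst degree_power_eq) auto
    moreover have "Suc (degree (a j)) * 1 \<le> Suc (degree (a j)) * degree m"
      using assms(3) by (intro mult_left_mono) auto
    ultimately show False by simp
  qed
qed

text \<open>This lets a candidate for position \<open>i\<close> compete at every earlier position
  \<open>k\<close>.\<close>

lemma A_independent_move:
  assumes "A_independent emb i (v(i := x))" "1 \<le> k" "k \<le> i"
  shows "A_independent emb k (v(k := x))"
  unfolding A_independent_def
proof (intro allI impI)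
  fix a assume a: "(\<Sum>j=1..k. emb (a j) * (v(k := x)) j) = 0"
  \<comment> \<open>The coefficient of \<open>x\<close> moves from position \<open>k\<close> to
    \<open>i\<close>, with zeros in between.\<close>
  define a' where "a' j = (if j < k then a j else if j = i then a k else 0)" for j
  have split: "{1..i} = insert i {1..<i}" "{1..k} = insert k {1..<k}" using assms by auto
  have "(\<Sum>j\<in>{1..<i}. emb (a' j) * (v(i := x)) j) = (\<Sum>j\<in>{1..<k}. emb (a j) * (v(k := x)) j)"
    using assms by (intro sum.mono_neutral_cong_right) (auto simp: a'_def map_0)
  hence "(\<Sum>j=1..i. emb (a' j) * (v(i := x)) j) = (\<Sum>j=1..k. emb (a j) * (v(k := x)) j)"
    unfolding split using assms by (simp add: a'_def)
  hence a'0: "\<forall>j\<in>{1..i}. a' j = 0"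
    using a assms(1) unfolding A_independent_def by simp
  show "\<forall>j\<in>{1..k}. a j = 0"
  proof
    fix j assume j: "j \<in> {1..k}"
    show "a j = 0"
    proof (cases "j = k")
      case True
      thus ?thesis using a'0[rule_format, of i] assms by (simp add: a'_def)
    next
      case False
      thus ?thesis using a'0[rule_format, of j] j assms by (simp add: a'_def)
    qed
  qed
qed

section \<open>Successive minimum bases\<close>

text \<open>The vector \<open>v i\<close> itself competes at position \<open>j\<close>.\<close>

lemma SMB_lattice_mono:
  assumes "SMB_lattice emb r \<Lambda> v" "1 \<le> j" "j \<le> i" "i \<le> r"
  shows "absv (v j) \<le> absv (v i)"
proof -
  have "A_independent emb i (v(i := v i))" "v i \<in> \<Lambda>"
    using assms unfolding SMB_lattice_def by auto
  moreover have "A_independent emb j (v(j := v i))"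
    using A_independent_move[OF calculation(1) assms(2,3)] .
  ultimately show ?thesis using assms unfolding SMB_lattice_def by auto
qed

lemma SMB_lattice_first_le:
  assumes "SMB_lattice emb r \<Lambda> v" "r \<ge> 1" "x \<in> \<Lambda>" "x \<noteq> 0"
  shows "absv (v 1) \<le> absv x"
proof -
  have "A_independent emb 1 (v(1 := x))"
    using assms(4) by (simp add: A_independent_def)
  thus ?thesis using assms unfolding SMB_lattice_def by auto
qed

lemma SMB_lattice_nonzero:
  assumes "SMB_lattice emb r \<Lambda> v" "i \<in> {1..r}"
  shows "v i \<noteq> 0"
proof
  assume 0: "v i = 0"
  have "A_independent emb i v" using assms unfolding SMB_lattice_def by auto
  moreover have "(\<Sum>j=1..i. emb (if j = i then 1 else 0) * v j) = 0"
    by (intro sum.neutral) (auto simp: 0 map_0)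
  ultimately have "\<forall>j\<in>{1..i}. (if j = i then 1 else 0 :: 'k poly) = 0"
    unfolding A_independent_def by fast
  thus False using assms(2) by force
qed

text \<open>
  After reducing the coefficients modulo \<open>u\<close>, a nontrivial relation would produce a lattice
  vector shorter than the last \<open>v k\<close> occurring in it, against the minimality of \<open>v k\<close>.
\<close>

lemma SMB_lattice_indep_mod:
  assumes smb: "SMB_lattice emb r \<Lambda> v" and sub: "submod emb \<Lambda>" and u: "degree u > 0"
    and i: "i \<le> r" and x: "x \<in> \<Lambda>" and rel: "(\<Sum>j=1..i. emb (a j) * v j) = emb u * x"
  shows "\<forall>j\<in>{1..i}. u dvd a j"
proof (rule ccontr)
  assume contr: "\<not> ?thesis"
  have u0: "u \<noteq> 0" using u by auto
  have vL: "v j \<in> \<Lambda>" if "j \<in> {1..i}" for j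
    using smb that i unfolding SMB_lattice_def by auto
  define b where "b j = a j mod u" for j
  \<comment> \<open>Absorbing the quotients into the lattice vector leaves a relation with
    coefficients of degree below that of \<open>u\<close>.\<close>
  define x' where "x' = x - (\<Sum>j=1..i. emb (a j div u) * v j)"
  have x': "x' \<in> \<Lambda>"
    unfolding x'_def by (intro submod_diff submod_sum submod_mult sub x vL)
  have "emb (a j) = emb u * emb (a j div u) + emb (b j)" for j
    unfolding b_def by (metis emb_add emb_mult mult_div_mod_eq)
  hence relb: "(\<Sum>j=1..i. emb (b j) * v j) = emb u * x'"
    using rel by (simp add: x'_def algebra_simps sum.distrib sum_distrib_left)
  define T where "T = {j \<in> {1..i}. b j \<noteq> 0}"
  define k where "k = Max T"
  have "finite T" "T \<noteq> {}"
    using contr by (auto simp: T_def b_def mod_eq_0_iff_dvd)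
  hence "k \<in> T" and kmax: "\<And>j. j \<in> T \<Longrightarrow> j \<le> k" by (auto simp: k_def)
  hence k: "1 \<le> k" "k \<le> i" "b k \<noteq> 0" by (auto simp: T_def)
  have "b j = 0" if "j \<in> {1..i} - {1..k}" for j
    using that kmax[of j] by (auto simp: T_def)
  hence "(\<Sum>j=1..i. emb (b j) * v j) = (\<Sum>j=1..k. emb (b j) * v j)"
    using k by (intro sum.mono_neutral_right) (auto simp: map_0)
  hence relk: "(\<Sum>j=1..k. emb (b j) * v j) = emb u * x'" using relb by simp
  have split: "{1..k} = insert k {1..<k}" using k by auto
  have indv: "A_independent emb k v" using smb k i unfolding SMB_lattice_def by auto
  have "A_independent emb k (v(k := x'))"
    unfolding A_independent_def
  proof (intro allI impI)
    fix c assume "(\<Sum>j=1..k. emb (c j) * (v(k := x')) j) = 0"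
    moreover have "(\<Sum>j\<in>{1..<k}. emb (c j) * (v(k := x')) j) = (\<Sum>j\<in>{1..<k}. emb (c j) * v j)"
      by (intro sum.cong) auto
    ultimately have "emb (c k) * x' + (\<Sum>j\<in>{1..<k}. emb (c j) * v j) = 0"
      unfolding split by simp
    hence "emb (c k) * (emb u * x') + emb u * (\<Sum>j\<in>{1..<k}. emb (c j) * v j) = 0"
      by (metis distrib_left mult.left_commute mult_zero_right)
    \<comment> \<open>These coefficients arise on multiplying by \<open>u\<close> and replacing
      \<open>u\<close> times \<open>x'\<close> by the combination with coefficients
      \<open>b\<close>. As \<open>b k\<close> is nonzero, the last one yields
      \<open>c k = 0\<close>.\<close>
    moreover define e where "e j = (if j = k then c k * b k else c k * b j + u * c j)" for j
    have "(\<Sum>j=1..k. emb (e j) * v j) =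
        emb (c k) * (\<Sum>j=1..k. emb (b j) * v j) + emb u * (\<Sum>j\<in>{1..<k}. emb (c j) * v j)"
    proof -
      have "(\<Sum>j\<in>{1..<k}. emb (e j) * v j) =
          (\<Sum>j\<in>{1..<k}. emb (c k) * (emb (b j) * v j) + emb u * (emb (c j) * v j))"
        by (intro sum.cong) (auto simp: e_def emb_add emb_mult algebra_simps)
      thus ?thesis
        unfolding split
        by (simp add: e_def emb_mult distrib_left sum.distrib sum_distrib_left algebra_simps)
    qed
    ultimately have "(\<Sum>j=1..k. emb (e j) * v j) = 0" unfolding relk by simp
    hence e0: "\<forall>j\<in>{1..k}. e j = 0" using indv unfolding A_independent_def by blast
    hence ck: "c k = 0" using k by (force simp: e_def)
    show "\<forall>j\<in>{1..k}. c j = 0"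
    proof
      fix j assume "j \<in> {1..k}"
      thus "c j = 0" using e0[rule_format, of j] ck u0 by (cases "j = k") (auto simp: e_def)
    qed
  qed
  hence le: "absv (v k) \<le> absv x'"
    using smb x' k i unfolding SMB_lattice_def by auto
  have vk: "v k \<noteq> 0" using SMB_lattice_nonzero[OF smb] k i by simp
  \<comment> \<open>The reduced coefficients are smaller than \<open>u\<close>, and no
    \<open>v j\<close> here is longer than \<open>v k\<close>; hence \<open>x'\<close> is shorter
    than \<open>v k\<close>.\<close>
  have "absv (\<Sum>j=1..k. emb (b j) * v j) < absv (emb u) * absv (v k)"
  proof (rule absv_sum_less)
    show "0 < absv (emb u) * absv (v k)" using u0 vk by simp
    fix j assume j: "j \<in> {1..k}"
    have "degree (b j) < degree u"
      unfolding b_def using degree_mod_less'[OF u0] u by (cases "a j mod u = 0") auto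
    hence "absv (emb (b j)) < absv (emb u)" by (rule absv_emb_less)
    moreover have "absv (v j) \<le> absv (v k)"
      using SMB_lattice_mono[OF smb] j k i by simp
    moreover have "absv (v j) > 0" using SMB_lattice_nonzero[OF smb] j k i by simp
    ultimately show "absv (emb (b j) * v j) < absv (emb u) * absv (v k)"
      unfolding absv_mult by (intro mult_less_le_imp_less) auto
  qed
  hence "absv (emb u) * absv x' < absv (emb u) * absv (v k)"
    unfolding relk absv_mult .
  thus False using le u0 by simp
qed

section \<open>Torsion of a Drinfeld module\<close>

text \<open>Translation by 1 permutes the finite field; comparing sums over it gives q = 0 there,
  and \<open>emb\<close> carries this over.\<close>

lemma of_nat_CARD_eq_0: "of_nat CARD('k) = (0::'c)"
proof -
  have "(\<Sum>x\<in>UNIV. x + 1) = (\<Sum>x\<in>UNIV. x :: 'k)"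
    by (intro sum.reindex_bij_witness[of _ "\<lambda>x. x - 1" "\<lambda>x. x + 1"]) auto
  hence "of_nat CARD('k) = (0::'k)" by (simp add: sum.distrib)
  hence "of_nat CARD('k) = (0::'k poly)" by (simp add: of_nat_poly)
  thus ?thesis by (metis map_0 map_of_nat)
qed

lemma coeff_drinfeld_0:
  assumes "drinfeld_module emb K r \<phi>"
  shows "coeff (\<phi> a) 0 = 0"
proof (rule ccontr)
  assume "coeff (\<phi> a) 0 \<noteq> 0"
  then obtain i where "0 = CARD('k) ^ i"
    using assms unfolding drinfeld_module_def twisted_polys_def by blast
  thus False by simp
qed

lemma coeff_pcompose_1:
  fixes p s :: "'c poly"
  assumes "coeff s 0 = 0"
  shows "coeff (pcompose p s) 1 = coeff p 1 * coeff s 1"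
proof (cases p)
  case (pCons a p')
  have "coeff (pcompose p' s) 0 = coeff p' 0"
    using assms by (metis poly_0_coeff_0 poly_pcompose)
  thus ?thesis using assms by (simp add: pCons pcompose_pCons coeff_mult coeff_pCons)
qed

text \<open>The linear coefficient is prescribed for constants and for t. Linear coefficients
  multiply under composition, so induction along c + t p reaches every element of A.\<close>

lemma coeff_drinfeld_1:
  assumes "drinfeld_module emb K r \<phi>"
  shows "coeff (\<phi> a) 1 = emb a"
proof (induction a)
  case 0
  have "\<phi> (0 + 0) = \<phi> 0 + \<phi> 0" using assms unfolding drinfeld_module_def by blast
  hence "\<phi> 0 = 0" using add_cancel_left_right[of "\<phi> 0" "\<phi> 0"] by simp
  thus ?case by (simp add: map_0)
next
  case (pCons c p)
  obtain g where g: "\<phi> [:0, 1:] = monom (emb [:0, 1:]) 1 + (\<Sum>i=1..r. monom (g i) (CARD('k) ^ i))"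
    using assms unfolding drinfeld_module_def by blast
  have "CARD('k) ^ i \<noteq> 1" if "i \<in> {1..r}" for i
    using CARD_gt_1 that by auto
  hence t: "coeff (\<phi> [:0, 1:]) 1 = emb [:0, 1:]"
    unfolding g by (simp add: coeff_sum)
  have eq: "pCons c p = [:c:] + [:0, 1:] * p" by simp
  have "\<phi> (pCons c p) = [:0, emb [:c:]:] + pcompose (\<phi> [:0, 1:]) (\<phi> p)"
    using assms unfolding eq drinfeld_module_def by metis
  hence "coeff (\<phi> (pCons c p)) 1 = emb [:c:] + emb [:0, 1:] * emb p"
    using coeff_pcompose_1[OF coeff_drinfeld_0[OF assms]] t pCons.IH by simp
  thus ?case unfolding eq emb_add emb_mult .
qed

text \<open>Terms of exponent q^i with i > 0 differentiate to 0, since q = 0 in the field.\<close>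

lemma pderiv_drinfeld:
  assumes "drinfeld_module emb K r \<phi>"
  shows "pderiv (\<phi> a) = [:emb a:]"
proof (rule poly_eqI)
  fix m
  show "coeff (pderiv (\<phi> a)) m = coeff [:emb a:] m"
  proof (cases "m = 0")
    case True
    thus ?thesis using coeff_drinfeld_1[OF assms, of a] by (simp add: coeff_pderiv)
  next
    case False
    have "of_nat (Suc m) * coeff (\<phi> a) (Suc m) = 0"
    proof (cases "coeff (\<phi> a) (Suc m) = 0")
      case nz: False
      then obtain i where i: "Suc m = CARD('k) ^ i"
        using assms unfolding drinfeld_module_def twisted_polys_def by blast
      hence "i \<noteq> 0" using False by (cases i) auto
      hence "of_nat (Suc m) = (0::'c)"
        unfolding i of_nat_power by (simp add: of_nat_CARD_eq_0)
      thus ?thesis by simp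
    qed simp
    moreover have "coeff [:emb a:] m = 0" using False by (cases m) auto
    ultimately show ?thesis by (simp only: coeff_pderiv)
  qed
qed

text \<open>The derivative is a nonzero constant, so the polynomial is separable and all its roots
  lie in the separable closure.\<close>

lemma torsion_eq_roots:
  assumes dm: "drinfeld_module emb K r \<phi>" and "a \<noteq> 0"
  shows "torsion K \<phi> a = {x. poly (\<phi> a) x = 0}"
proof -
  have "is_unit [:emb a:]"
    using assms(2) by (simp add: is_unit_const_poly_iff dvd_field_iff)
  hence "coprime (\<phi> a) (pderiv (\<phi> a))"
    unfolding pderiv_drinfeld[OF dm] by (rule is_unit_right_imp_coprime)
  moreover have "set (coeffs (\<phi> a)) \<subseteq> K"
    using dm unfolding drinfeld_module_def twisted_polys_def by blast
  moreover have "\<phi> a \<noteq> 0"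
    using coeff_drinfeld_1[OF dm, of a] assms(2) by auto
  ultimately show ?thesis unfolding torsion_def separable_closure_def by blast
qed

lemma A_lattice_submod:
  assumes "A_lattice emb r \<Lambda>"
  shows "submod emb \<Lambda>"
proof -
  obtain b where \<Lambda>: "\<Lambda> = {\<Sum>j=1..r. emb (a j) * b j | a. True}"
    using assms unfolding A_lattice_def by blast
  define f where "f a = (\<Sum>j=1..r. emb (a j) * b j)" for a
  have "f (\<lambda>_. 0) = 0" by (simp add: f_def map_0)
  moreover have "f a + f a' = f (\<lambda>j. a j + a' j)" for a a'
    by (simp add: f_def emb_add distrib_right sum.distrib)
  moreover have "emb c * f a = f (\<lambda>j. c * a j)" for c a
    by (simp add: f_def emb_mult sum_distrib_left mult.assoc)
  moreover have "\<Lambda> = range f" by (auto simp: \<Lambda> f_def)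
  ultimately show ?thesis
    unfolding submod_def by (auto intro: range_eqI[OF sym])
qed

end

section \<open>The uniformization as an A-linear map with kernel \<Lambda>\<close>

locale drinfeld_uniformization = infinite_completion emb F w K
  for emb :: "'k::{finite,field} poly \<Rightarrow> 'c::{field,complete_space}"
    and F :: "'c set" and w :: "'c \<Rightarrow> int" and K :: "'c set" +
  fixes r :: nat and \<Lambda> :: "'c set" and \<phi> :: "'k poly \<Rightarrow> 'c poly"
  assumes drinfeld: "drinfeld_module emb K r \<phi>"
    and uniformizes: "uniformizes emb K r \<Lambda> \<phi>"
begin

abbreviation "E \<equiv> lattice_exp \<Lambda>"

lemma rank_ge_1: "r \<ge> 1"
  using drinfeld unfolding drinfeld_module_def by blast

lemma lattice_submod: "submod emb \<Lambda>"
  using uniformizes A_lattice_submod unfolding uniformizes_def by blast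

lemma lattice_finite: "finite {x \<in> \<Lambda>. absv x \<le> R}"
  using uniformizes unfolding uniformizes_def A_lattice_def by blast

lemma E_eq_0_iff: "E z = 0 \<longleftrightarrow> z \<in> \<Lambda>"
  using uniformizes unfolding uniformizes_def by blast

lemma E_mult: "E (emb a * z) = poly (\<phi> a) (E z)"
  using uniformizes unfolding uniformizes_def by blast

lemma E_surj: "\<exists>z. E z = x"
  using uniformizes unfolding uniformizes_def by (metis surjD)

lemma E_add: "E (x + y) = E x + E y"
  by (rule lattice_exp_additive[OF lattice_finite lattice_submod])

lemma E_diff: "E (x - y) = E x - E y"
  using E_add[of "x - y" y] by (simp add: algebra_simps)

lemma E_sum: "E (sum f S) = (\<Sum>x\<in>S. E (f x))"
proof (induction S rule: infinite_finite_induct)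
  case (insert x S)
  thus ?case by (simp add: E_add)
qed (use E_eq_0_iff submod_0[OF lattice_submod] in auto)

text \<open>By linearity, a relation among the \<open>l j\<close> means that the same combination of
  lifts lies in the kernel \<Lambda>. Any choice of lifts serves.\<close>

lemma torsion_independent_iff:
  assumes "\<And>j. j \<in> {1..i} \<Longrightarrow> E (z j) = l j"
  shows "torsion_independent \<phi> m i l \<longleftrightarrow> indep_mod emb m \<Lambda> {1..i} z"
proof -
  have "(\<Sum>j=1..i. poly (\<phi> (a j)) (l j)) = E (\<Sum>j=1..i. emb (a j) * z j)" for a
    unfolding E_sum E_mult using assms by (intro sum.cong) auto
  thus ?thesis unfolding torsion_independent_def indep_mod_def E_eq_0_iff[symmetric] by simp
qed

text \<open>Subtracting a nearest lattice vector from any preimage gives one that is shortest in its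
  coset, and \<open>E\<close> does not shorten such a vector.\<close>

lemma reduced_preimage: "\<exists>z. E z = x \<and> absv z \<le> absv x"
proof -
  obtain z0 where z0: "E z0 = x" using E_surj by blast
  obtain \<nu> where \<nu>: "\<nu> \<in> \<Lambda>" "\<And>\<mu>. \<mu> \<in> \<Lambda> \<Longrightarrow> absv (z0 - \<nu>) \<le> absv (z0 - \<nu> - \<mu>)"
    using reduced_representative[OF lattice_finite lattice_submod] by blast
  have "E (z0 - \<nu>) = x" using \<nu>(1) z0 E_eq_0_iff by (simp add: E_diff)
  thus ?thesis using absv_lattice_exp_reduced[OF lattice_finite \<nu>(2)] by metis
qed

section \<open>Sizes of lifts and of torsion points\<close>

context
  fixes \<omega> :: "nat \<Rightarrow> 'c"
  assumes smb: "SMB_lattice emb r \<Lambda> \<omega>"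
begin

lemma absv_E_small:
  assumes "absv z < absv (\<omega> 1)"
  shows "absv (E z) = absv z"
proof (rule absv_lattice_exp_small[OF lattice_finite])
  fix \<mu> assume "\<mu> \<in> \<Lambda> - {0}"
  thus "absv z < absv \<mu>"
    using SMB_lattice_first_le[OF smb rank_ge_1, of \<mu>] assms by auto
qed

text \<open>Two such preimages differ by a lattice vector shorter than
  \<open>\<omega> 1\<close>.\<close>

lemma E_inj_small:
  assumes "absv z < absv (\<omega> 1)" "absv z' < absv (\<omega> 1)" "E z = E z'"
  shows "z = z'"
proof (rule ccontr)
  assume "z \<noteq> z'"
  moreover have "z - z' \<in> \<Lambda>" using assms(3) by (simp add: E_diff flip: E_eq_0_iff)
  ultimately have "absv (\<omega> 1) \<le> absv (z - z')"
    using SMB_lattice_first_le[OF smb rank_ge_1] by simp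
  thus False using absv_diff_le[of z z'] assms by simp
qed

text \<open>Exchange provides some j <= i for which the exponential of \<omega>_j/u^n is admissible
  in place of \<open>l i\<close>. Maximality of the valuation of \<open>l i\<close> then bounds |l
  i| by |\<omega>_j|/|u^n|.\<close>

lemma SMB_torsion_absv_le:
  assumes u: "prime_elem u" and n: "n > 0"
    and large: "absv (\<omega> r) / absv (\<omega> 1) < absv (emb (u ^ n))"
    and l: "SMB_torsion emb w K r \<phi> (u ^ n) l" and i: "i \<in> {1..r}"
  shows "absv (l i) \<le> absv (\<omega> i) / absv (emb (u ^ n))"
proof -
  have u0: "u \<noteq> 0" and nu: "\<not> u dvd 1" using u by (auto simp: prime_elem_def)
  have degu: "degree u > 0" using u0 nu is_unit_iff_degree by auto
  define m where "m = u ^ n"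
  have m0: "m \<noteq> 0" using u0 by (simp add: m_def)
  have umul: "u ^ (n - 1) * u = m" unfolding m_def by (rule power_minus_mult[OF n])
  define N where "N = {x. emb (u ^ (n - 1)) * x \<in> \<Lambda>}"
  have N: "submod emb N" unfolding N_def by (rule submod_preimage[OF lattice_submod])
  have power_iff: "indep_mod emb m \<Lambda> J v \<longleftrightarrow> indep_mod emb u N J v" for J v
    unfolding m_def N_def using u0 by (intro indep_mod_power_iff lattice_submod n) auto
  define z where "z k = (SOME x. E x = l k)" for k
  have z: "E (z k) = l k" for k unfolding z_def by (rule someI_ex) (rule E_surj)
  define y where "y j = \<omega> j / emb m" for j
  have my: "emb m * y j = \<omega> j" for j using m0 by (simp add: y_def)
  have \<omega>L: "\<omega> j \<in> \<Lambda>" if "j \<in> {1..i}" for j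
    using smb that i unfolding SMB_lattice_def by auto
  have split: "{1..i} = insert i {1..<i}" using i by auto
  have mulN: "emb u * x \<in> N \<longleftrightarrow> emb m * x \<in> \<Lambda>" for x
    unfolding N_def mem_Collect_eq umul[symmetric] emb_mult by (simp add: mult.assoc)
  have "\<exists>j\<in>{1..i}. indep_mod emb u N (insert i {1..<i}) (z(i := y j))"
  proof (rule steinitz_exchange[OF _ nu N])
    show "u dvd x \<or> u dvd x'" if "u dvd x * x'" for x x'
      using u that prime_elem_dvd_mult_iff by blast
    have "torsion_independent \<phi> m i l" using l i unfolding SMB_torsion_def m_def by blast
    hence "indep_mod emb u N {1..i} z"
      using torsion_independent_iff[of i z l] z power_iff by simp
    thus "indep_mod emb u N {1..<i} z" by (rule indep_mod_subset[OF N]) auto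
    show "indep_mod emb u N {1..i} y"
      unfolding indep_mod_def
    proof (intro allI impI)
      fix a assume "(\<Sum>j=1..i. emb (a j) * y j) \<in> N"
      hence x: "emb (u ^ (n - 1)) * (\<Sum>j=1..i. emb (a j) * y j) \<in> \<Lambda>" by (simp add: N_def)
      \<comment> \<open>One more factor \<open>u\<close> exhibits a combination of the
        \<open>\<omega> j\<close> as \<open>u\<close> times a lattice vector, to which independence
        modulo \<open>u\<close> applies.\<close>
      have "emb u * (emb (u ^ (n - 1)) * (\<Sum>j=1..i. emb (a j) * y j)) =
          emb m * (\<Sum>j=1..i. emb (a j) * y j)"
        unfolding umul[symmetric] emb_mult by (simp add: ac_simps)
      also have "\<dots> = (\<Sum>j=1..i. emb (a j) * \<omega> j)"
        unfolding sum_distrib_left my[symmetric] by (simp add: mult.left_commute)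
      finally show "\<forall>j\<in>{1..i}. u dvd a j"
        using SMB_lattice_indep_mod[OF smb lattice_submod degu _ x, of i a] i
        by (metis atLeastAtMost_iff)
    qed
    show "emb u * z k \<in> N" if "k \<in> {1..<i}" for k
    proof -
      have "l k \<in> torsion K \<phi> m" using l that i unfolding SMB_torsion_def m_def by auto
      hence "E (emb m * z k) = 0" by (simp add: E_mult z torsion_def)
      thus ?thesis by (simp add: mulN E_eq_0_iff)
    qed
    show "emb u * y j \<in> N" if "j \<in> {1..i}" for j
      using \<omega>L[OF that] by (simp add: mulN my)
  qed (use i in auto)
  then obtain j where j: "j \<in> {1..i}" and ind: "indep_mod emb m \<Lambda> {1..i} (z(i := y j))"
    unfolding power_iff split by blast
  have "E ((z(i := y j)) k) = (l(i := E (y j))) k" for k by (simp add: z)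
  hence "torsion_independent \<phi> m i (l(i := E (y j)))"
    using torsion_independent_iff ind by blast
  moreover have "poly (\<phi> m) (E (y j)) = 0"
    using \<omega>L[OF j] by (simp add: my E_eq_0_iff flip: E_mult)
  hence "E (y j) \<in> torsion K \<phi> m" using torsion_eq_roots[OF drinfeld m0] by simp
  ultimately have "w_ext emb w (E (y j)) \<le> w_ext emb w (l i)"
    using l i unfolding SMB_torsion_def m_def by blast
  hence "absv (l i) \<le> absv (E (y j))" by (rule w_ext_le_imp_absv_le)
  also have "absv (E (y j)) = absv (y j)"
  proof (rule absv_E_small)
    \<comment> \<open>The size condition on \<open>u ^ n\<close> makes every \<open>y j\<close>
      shorter than \<open>\<omega> 1\<close>, so that \<open>E\<close> preserves its absolute
      value.\<close>
    have "absv (\<omega> j) \<le> absv (\<omega> r)" using SMB_lattice_mono[OF smb] j i by simp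
    also have "absv (\<omega> r) < absv (emb m) * absv (\<omega> 1)"
      using large SMB_lattice_nonzero[OF smb, of 1] rank_ge_1 by (simp add: m_def divide_less_eq)
    finally show "absv (y j) < absv (\<omega> 1)"
      using m0 by (simp add: y_def absv_divide divide_less_eq mult.commute)
  qed
  also have "\<dots> = absv (\<omega> j) / absv (emb m)" by (simp add: y_def absv_divide)
  also have "\<dots> \<le> absv (\<omega> i) / absv (emb m)"
    using SMB_lattice_mono[OF smb, of j i] j i by (intro divide_right_mono) auto
  finally show ?thesis unfolding m_def .
qed

text \<open>
  If \<open>x\<close> were shorter than \<open>\<eta> i\<close>, then for the first \<open>k\<close> with \<open>\<omega> k\<close> longer than \<open>x\<close>, the \<open>k\<close>
  independent vectors \<open>\<eta> 1, \<dots>, \<eta> (k - 1), x\<close> would all be shorter than \<open>\<omega> k\<close>, and one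
  of them would be independent of \<open>\<omega> 1, \<dots>, \<omega> (k - 1)\<close>.
\<close>

lemma SMB_lattice_if_le:
  assumes "\<And>i. i \<in> {1..r} \<Longrightarrow> \<eta> i \<in> \<Lambda>" and "A_independent emb r \<eta>"
    and le: "\<And>i. i \<in> {1..r} \<Longrightarrow> absv (\<eta> i) \<le> absv (\<omega> i)"
  shows "SMB_lattice emb r \<Lambda> \<eta>"
  unfolding SMB_lattice_def
proof (intro ballI conjI impI)
  fix i assume i: "i \<in> {1..r}"
  show "\<eta> i \<in> \<Lambda>" using assms i by blast
  show "A_independent emb i \<eta>"
    using assms(2) i indep_mod_subset[OF submod_zero]
    unfolding A_independent_iff_indep_mod by fastforce
  fix x assume x: "x \<in> \<Lambda>" and ind: "A_independent emb i (\<eta>(i := x))"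
  show "absv (\<eta> i) \<le> absv x"
  proof (rule ccontr)
    assume "\<not> ?thesis"
    \<comment> \<open>By \<open>le\<close> the index \<open>i\<close> qualifies in the definition of
      \<open>k\<close>, which ensures that \<open>k\<close> exists and is at most
      \<open>i\<close>.\<close>
    hence xi: "1 \<le> i \<and> absv x < absv (\<omega> i)" using le[OF i] i by auto
    define k where "k = (LEAST k. 1 \<le> k \<and> absv x < absv (\<omega> k))"
    have k: "1 \<le> k" "absv x < absv (\<omega> k)" and ki: "k \<le> i"
      using LeastI[of "\<lambda>k. 1 \<le> k \<and> absv x < absv (\<omega> k)", OF xi]
        Least_le[of "\<lambda>k. 1 \<le> k \<and> absv x < absv (\<omega> k)", OF xi]
      unfolding k_def by auto
    have below: "absv (\<omega> j) \<le> absv x" if "1 \<le> j" "j < k" for j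
      using not_less_Least[of j "\<lambda>k. 1 \<le> k \<and> absv x < absv (\<omega> k)"] that
      unfolding k_def[symmetric] by auto
    have \<omega>k: "A_independent emb k \<omega>"
      using smb i k ki unfolding SMB_lattice_def by auto
    define y where "y = \<eta>(k := x)"
    have "\<exists>j\<in>{1..k}. indep_mod emb 0 {0} (insert k {1..<k}) (\<omega> (k := y j))"
    proof (rule steinitz_exchange[OF _ _ submod_zero])
      show "indep_mod emb 0 {0} {1..<k} \<omega>"
        using \<omega>k indep_mod_subset[OF submod_zero, of 0 "{1..k}" \<omega> "{1..<k}"]
        unfolding A_independent_iff_indep_mod by fastforce
      show "indep_mod emb 0 {0} {1..k} y"
        using A_independent_move[OF ind k(1) ki] unfolding y_def A_independent_iff_indep_mod .
    qed (use k in \<open>auto simp: map_0\<close>)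
    moreover have "insert k {1..<k} = {1..k}" using k by auto
    ultimately obtain j where j: "j \<in> {1..k}" "A_independent emb k (\<omega> (k := y j))"
      unfolding A_independent_iff_indep_mod by auto
    have "y j \<in> \<Lambda>" using assms(1)[of j] x j(1) i ki by (auto simp: y_def)
    hence \<omega>le: "absv (\<omega> k) \<le> absv (y j)"
      using smb j(2) i k ki unfolding SMB_lattice_def by auto
    show False
    proof (cases "j = k")
      case True
      thus ?thesis using \<omega>le k by (simp add: y_def)
    next
      case False
      \<comment> \<open>Here |\<eta> j| <= |\<omega> j| <= |x| < |\<omega> k|, the middle inequality
        by minimality of \<open>k\<close>.\<close>
      thus ?thesis using \<omega>le le[of j] below[of j] k j(1) i ki by (auto simp: y_def)
    qed
  qed
qed

end

end

section \<open>Short lifts of the torsion basis and the lattice basis they give\<close>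

theorem theorem3p2:
  fixes emb :: "'k::{finite,field} poly \<Rightarrow> 'c::{field,complete_space}"
    and F K \<Lambda> :: "'c set" and w :: "'c \<Rightarrow> int" and r n :: nat
    and \<phi> :: "'k poly \<Rightarrow> 'c poly" and u :: "'k poly" and \<omega> l :: "nat \<Rightarrow> 'c"
  assumes "infinite_completion emb F w K"
    and "drinfeld_module emb K r \<phi>"
    and "uniformizes emb K r \<Lambda> \<phi>"
    and "SMB_lattice emb r \<Lambda> \<omega>"
    and "irreducible u" and "lead_coeff u = 1"
    and "n > 0"
    and "absv (emb (u ^ n)) > absv (\<omega> r) / absv (\<omega> 1)"
    and "SMB_torsion emb w K r \<phi> (u ^ n) l"
  shows "(\<forall>i\<in>{1..r}. \<exists>!z. absv z < absv (\<omega> 1) \<and> lattice_exp \<Lambda> z = l i) \<and>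
    (\<forall>\<omega>'. (\<forall>i\<in>{1..r}. absv (\<omega>' i) < absv (\<omega> 1) \<and> lattice_exp \<Lambda> (\<omega>' i) = l i) \<longrightarrow>
       SMB_lattice emb r \<Lambda> (\<lambda>i. emb (u ^ n) * \<omega>' i))"
proof -
  interpret drinfeld_uniformization emb F w K r \<Lambda> \<phi>
    using assms(1-3) by (simp add: drinfeld_uniformization_def drinfeld_uniformization_axioms_def)
  note smb = assms(4)
  define m where "m = u ^ n"
  have u: "prime_elem u" using assms(5) by (rule field_poly_irreducible_imp_prime)
  have degu: "degree u > 0"
    using u is_unit_iff_degree[of u] by (auto simp: prime_elem_def)
  have "u \<noteq> 0" using degu by auto
  hence m0: "m \<noteq> 0" and degm: "degree m > 0"
    using degu assms(7) by (auto simp: m_def degree_power_eq)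
  have bound: "absv (l i) \<le> absv (\<omega> i) / absv (emb m)" if "i \<in> {1..r}" for i
    using SMB_torsion_absv_le[OF smb u assms(7,8,9) that] unfolding m_def .
  have small: "absv (\<omega> i) / absv (emb m) < absv (\<omega> 1)" if "i \<in> {1..r}" for i
  proof -
    have "absv (\<omega> i) \<le> absv (\<omega> r)" using SMB_lattice_mono[OF smb] that by simp
    also have "absv (\<omega> r) < absv (emb m) * absv (\<omega> 1)"
      using assms(8) SMB_lattice_nonzero[OF smb, of 1] rank_ge_1 by (simp add: m_def divide_less_eq)
    finally show ?thesis using m0 by (simp add: divide_less_eq mult.commute)
  qed
  show ?thesis
  proof (intro conjI ballI allI impI)
    fix i assume i: "i \<in> {1..r}"
    obtain z where z: "lattice_exp \<Lambda> z = l i" "absv z \<le> absv (l i)"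
      using reduced_preimage by blast
    hence "absv z < absv (\<omega> 1)" using bound[OF i] small[OF i] by linarith
    thus "\<exists>!z. absv z < absv (\<omega> 1) \<and> lattice_exp \<Lambda> z = l i"
      using z E_inj_small[OF smb] by metis
  next
    fix \<omega>' assume \<omega>': "\<forall>i\<in>{1..r}. absv (\<omega>' i) < absv (\<omega> 1) \<and> lattice_exp \<Lambda> (\<omega>' i) = l i"
    have "SMB_lattice emb r \<Lambda> (\<lambda>i. emb m * \<omega>' i)"
    proof (rule SMB_lattice_if_le[OF smb])
      fix i assume i: "i \<in> {1..r}"
      have "l i \<in> torsion K \<phi> m" using assms(9) i unfolding SMB_torsion_def m_def by blast
      hence "lattice_exp \<Lambda> (emb m * \<omega>' i) = 0" using \<omega>' i by (simp add: E_mult torsion_def)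
      thus "emb m * \<omega>' i \<in> \<Lambda>" by (simp add: E_eq_0_iff)
      \<comment> \<open>Short vectors keep their size under the exponential, so the bound on
        \<open>l i\<close> passes to \<open>\<omega>' i\<close>.\<close>
      have "absv (\<omega>' i) = absv (l i)" using absv_E_small[OF smb, of "\<omega>' i"] \<omega>' i by simp
      thus "absv (emb m * \<omega>' i) \<le> absv (\<omega> i)"
        using bound[OF i] m0 by (simp add: absv_mult field_simps)
    next
      have "torsion_independent \<phi> m r l"
        using assms(9) rank_ge_1 unfolding SMB_torsion_def m_def by auto
      \<comment> \<open>The short lifts inherit independence modulo \<open>m\<close> from the
        \<open>l i\<close>, and descent turns it into independence over A.\<close>
      hence "indep_mod emb m \<Lambda> {1..r} \<omega>'" using torsion_independent_iff \<omega>' by blast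
      hence ind: "A_independent emb r \<omega>'"
        using indep_mod_imp_A_independent[OF lattice_submod] degm by blast
      have "(\<Sum>j=1..r. emb (a j) * (emb m * \<omega>' j)) = emb m * (\<Sum>j=1..r. emb (a j) * \<omega>' j)" for a
        by (simp add: sum_distrib_left mult.left_commute)
      thus "A_independent emb r (\<lambda>i. emb m * \<omega>' i)"
        using ind m0 unfolding A_independent_def by simp
    qed
    thus "SMB_lattice emb r \<Lambda> (\<lambda>i. emb (u ^ n) * \<omega>' i)" unfolding m_def .
  qed
qed

end
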